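(* In the setting described in the context, let $f\mapsto\sup_{y\in K}f(y)$ be measurable on $\mathbb{H}$, let $c=\int_{\mathbb{H}}\sup_{y\in K}f(y)\,H(\mathrm{d}f)<\infty$ and let $g^*(f)=c^{-1}\sup_{y\in K}f(y)$. Then the expected number of spectral functions considered by the stopping rule in the normalized spectral representation, $$Q_{g^*}=\mathbb{E}\min\Big\{m\in\mathbb{N}:\ \operatorname*{ess\,sup}_{f\in\mathbb{H}}\sup_{y\in K}\frac{f(y)}{g^*(f)Z^{(m)}(y)}\le\sum_{j=1}^{m+1}E_j\Big\},$$ satisfies $$Q_{g^*}\le c\cdot\mathbb{E}\Big[\Big(\inf_{y\in K}Z(y)\Big)^{-1}\Big].$$ In particular, if $\mathbb{E}\big[(\inf_{y\in K}Z(y))^{-1}\big]<\infty$, then $Q_{g^*}<\infty$.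
   Context: Setting. $K$ is a compact Polish space, $\mathbb{H}\subset[0,\infty)^K$ is a Polish space of functions, $H$ is a locally finite measure on $\mathbb{H}$ with $\int_{\mathbb{H}}f(y)\,H(\mathrm{d}f)=1$ for all $y\in K$. $Z(y)=\max_{(t,f)\in\Pi}tf(y)$, $y\in K$, with $\Pi$ a Poisson point process on $(0,\infty)\times\mathbb{H}$ with intensity $t^{-2}\,\mathrm{d}t\,H(\mathrm{d}f)$; it is assumed that $\mathbb{P}(\inf_{y\in K}Z(y)>0)=1$. Moreover the following is assumed on $\mathbb{H}$: (i) there is a countable set $K_0\subset K$ such that for all $h_1,h_2\in\mathbb{H}$: $h_1<h_2$ on $K$ if and only if there is $\varepsilon>0$ with $h_1(y)<h_2(y)-\varepsilon$ for all $y\in K_0$; (ii) $t_1h_1\vee t_2h_2\in\mathbb{H}$ for all $h_1,h_2\in\mathbb{H}$, $t_1,t_2\ge0$, and the constant function $\mathbf{1}\in\mathbb{H}$; (iii) $\mathbb{H}$ is endowed with the $\sigma$-algebra generated by the cylinder sets $\{h\in\mathbb{H}:h(y)\in B\}$, $y\in K$, $B\subset[0,\infty)$ Borel. Let $g^*H(A)=\int_Ag^*\,\mathrm{d}H$, a probability measure. $E_1,E_2,\dots$ are standard exponential and $f_1,f_2,\dots$ have law $g^*H$, all independent, and $$Z^{(m)}(y)=\max_{1\le i\le m}\frac{1}{\sum_{j=1}^iE_j}\frac{f_i(y)}{g^*(f_i)},\qquad y\in K.$$ The essential supremum is with respect to $g^*H$. Conventions: $\min\emptyset=\infty$; a positive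 number divided by $0$ is $+\infty$. *)

theory Defs
  imports "HOL-Probability.Probability"
begin

definition polish_topology :: "'a topology \<Rightarrow> bool" where
  "polish_topology T \<longleftrightarrow> completely_metrizable_space T \<and> separable_space T"

text \<open>Every point has a neighbourhood of finite measure. The neighbourhood need not be open,
  so the definition makes sense without assuming that open sets are measurable; if they are,
  one may equivalently ask for an open neighbourhood.\<close>

definition locally_finite_measure :: "'a topology \<Rightarrow> 'a measure \<Rightarrow> bool" where
  "locally_finite_measure T \<mu> \<longleftrightarrow>
     (\<forall>x\<in>topspace T. \<exists>U A. openin T U \<and> x \<in> U \<and> U \<subseteq> A \<and> A \<in> sets \<mu> \<and> emeasure \<mu> A < \<infinity>)"

definition cylinder_sets :: "('k \<Rightarrow> real) set \<Rightarrow> ('k \<Rightarrow> real) set set" where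
  "cylinder_sets HH = {{h \<in> HH. h y \<in> B} | y B. B \<in> sets borel \<and> B \<subseteq> {0..}}"

definition point_count :: "('w \<Rightarrow> 'a set) \<Rightarrow> 'a set \<Rightarrow> 'w \<Rightarrow> ennreal" where
  "point_count PP A \<omega> = emeasure (count_space UNIV) (PP \<omega> \<inter> A)"

text \<open>The point process is a random set of points, i.e. a simple one. For the intensities used
  here this is no restriction: the time component has a diffuse intensity, so that a Poisson
  process almost surely has no multiple points.\<close>

definition poisson_point_process :: "'w measure \<Rightarrow> 'a measure \<Rightarrow> ('w \<Rightarrow> 'a set) \<Rightarrow> bool" where
  "poisson_point_process M \<mu> PP \<longleftrightarrow>
     (\<forall>\<omega>\<in>space M. PP \<omega> \<subseteq> space \<mu>) \<and>
     (\<forall>A\<in>sets \<mu>. point_count PP A \<in> borel_measurable M) \<and>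
     (\<forall>A\<in>sets \<mu>. emeasure \<mu> A < \<infinity> \<longrightarrow>
        (\<forall>n::nat. measure M {\<omega>\<in>space M. point_count PP A \<omega> = of_nat n} =
           measure \<mu> A ^ n / fact n * exp (- measure \<mu> A))) \<and>
     (\<forall>A\<in>sets \<mu>. emeasure \<mu> A = \<infinity> \<longrightarrow> (AE \<omega> in M. point_count PP A \<omega> = \<infinity>)) \<and>
     (\<forall>(A :: nat \<Rightarrow> 'a set) n. (\<forall>i<n. A i \<in> sets \<mu>) \<and> disjoint_family_on A {..<n} \<longrightarrow>
        prob_space.indep_vars M (\<lambda>_. borel) (\<lambda>i. point_count PP (A i)) {..<n})"

definition spectral_intensity :: "('k \<Rightarrow> real) measure \<Rightarrow> (real \<times> ('k \<Rightarrow> real)) measure" where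
  "spectral_intensity H =
     density (restrict_space lborel {0<..}) (\<lambda>t. ennreal (1 / t\<^sup>2)) \<Otimes>\<^sub>M H"

definition max_stable :: "('w \<Rightarrow> (real \<times> ('k \<Rightarrow> real)) set) \<Rightarrow> 'w \<Rightarrow> 'k \<Rightarrow> ennreal" where
  "max_stable PP \<omega> y = (SUP (t, f)\<in>PP \<omega>. ennreal (t * f y))"

definition sup_const :: "('k \<Rightarrow> real) measure \<Rightarrow> ennreal" where
  "sup_const H = (\<integral>\<^sup>+ f. (SUP y. ennreal (f y)) \<partial>H)"

definition g_star :: "('k \<Rightarrow> real) measure \<Rightarrow> ('k \<Rightarrow> real) \<Rightarrow> ennreal" where
  "g_star H f = inverse (sup_const H) * (SUP y. ennreal (f y))"

definition Z_partial ::
  "(('k \<Rightarrow> real) \<Rightarrow> ennreal) \<Rightarrow> (nat \<Rightarrow> 'v \<Rightarrow> real) \<Rightarrow> (nat \<Rightarrow> 'v \<Rightarrow> ('k \<Rightarrow> real)) \<Rightarrow>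
    nat \<Rightarrow> 'v \<Rightarrow> 'k \<Rightarrow> ennreal" where
  "Z_partial g E f m \<omega> y =
     (MAX i\<in>{1..m}. 1 / ennreal (\<Sum>j=1..i. E j \<omega>) * (ennreal (f i \<omega> y) / g (f i \<omega>)))"

text \<open>In \<^typ>\<open>ennreal\<close>, a positive number divided by 0 is \<open>\<infinity>\<close>, whereas
  \<open>0 / 0 = 0\<close>: a function contributes nothing at points where it vanishes.
  The infimum of the empty set is \<open>\<infinity>\<close>; that of a nonempty set of naturals is its minimum.\<close>

definition stopping_number ::
  "('k \<Rightarrow> real) measure \<Rightarrow> (('k \<Rightarrow> real) \<Rightarrow> ennreal) \<Rightarrow> (nat \<Rightarrow> 'v \<Rightarrow> real) \<Rightarrow>
    (nat \<Rightarrow> 'v \<Rightarrow> ('k \<Rightarrow> real)) \<Rightarrow> 'v \<Rightarrow> ennreal" where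
  "stopping_number H g E f \<omega> =
     (INF m\<in>{m. 1 \<le> m \<and>
        esssup (density H g) (\<lambda>h. SUP y. ennreal (h y) / (g h * Z_partial g E f m \<omega> y))
          \<le> ennreal (\<Sum>j=1..m+1. E j \<omega>)}. of_nat m)"

definition Q_number ::
  "'v measure \<Rightarrow> ('k \<Rightarrow> real) measure \<Rightarrow> (('k \<Rightarrow> real) \<Rightarrow> ennreal) \<Rightarrow> (nat \<Rightarrow> 'v \<Rightarrow> real) \<Rightarrow>
    (nat \<Rightarrow> 'v \<Rightarrow> ('k \<Rightarrow> real)) \<Rightarrow> ennreal" where
  "Q_number N H g E f = (\<integral>\<^sup>+ \<omega>. stopping_number H g E f \<omega> \<partial>N)"

text \<open>All of \<open>E 1, E 2, \<dots>, f 1, f 2, \<dots>\<close> are jointly independent. As the two families have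
  different value types, this is stated for the generated sigma-algebras, indexed by
  a disjoint sum.\<close>

definition jointly_indep ::
  "'v measure \<Rightarrow> 'a measure \<Rightarrow> (nat \<Rightarrow> 'v \<Rightarrow> real) \<Rightarrow> (nat \<Rightarrow> 'v \<Rightarrow> 'a) \<Rightarrow> bool" where
  "jointly_indep N H E f \<longleftrightarrow>
     prob_space.indep_sets N
       (case_sum (\<lambda>j. {E j -` B \<inter> space N | B. B \<in> sets borel})
                 (\<lambda>i. {f i -` A \<inter> space N | A. A \<in> sets H}))
       ({1..} <+> {1..})"

end

theory Submission
  imports Defs
begin

text \<open>Let \<open>\<Gamma>\<^sub>i\<close> be the partial sums of the \<open>E\<^sub>j\<close> and \<open>I\<close> the infimum over \<open>K0\<close> of the maximum of all
  \<open>f\<^sub>i / (g\<^sup>* f\<^sub>i \<Gamma>\<^sub>i)\<close>. As \<open>f / g\<^sup>* f \<le> c\<close>, the rule has stopped by the time \<open>\<Gamma>\<^sub>m\<^sub>+\<^sub>1 > c / I\<close>, so at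
  most \<open>#{i. \<Gamma>\<^sub>i \<le> c / I}\<close> spectral functions are considered. Deleting the \<open>i\<close>-th point can only
  increase \<open>c / I\<close>, so Mecke's formula bounds the expectation of this number by
  \<open>\<integral>\<^sub>0\<^sup>\<infinity> P (x \<le> c / I) dx = c E [1 / I]\<close>. Finally \<open>I\<close> has the law of the infimum of \<open>Z\<close> over \<open>K0\<close>,
  because both fields have the same void probabilities \<open>P (\<forall>y\<in>G. Z y \<le> s)\<close> for finite \<open>G\<close>, and that
  infimum is at least the one over \<open>K\<close>.\<close>

text \<open>The level \<open>c / I\<close> depends on the very points that are counted against it,
  so the unit rate of the arrivals does not give the expected count directly. The level after
  deletion does not see where the deleted point lies in its gap; what remains is an integral over
  the gap, i.e. a length, and since the gaps tile the half-line, these lengths add up to at most the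
  level.

  The two representations are never coupled, and the normalized one is not shown to come from a
  Poisson process. Only laws of infima are compared. For the reciprocal of a minimum over a finite
  \<open>G\<close>, events with one common level \<open>s\<close> suffice, by inclusion-exclusion.
  Both probabilities are the exponential of minus the \<open>H\<close>-integral of the maximum over
  \<open>G\<close> divided by \<open>s\<close>: the density \<open>g_star\<close> in the law of the
  marks cancels the denominators.

  \<open>K0\<close> provides countability for measurability, and a uniform gap on \<open>K0\<close>
  is what condition (i) turns into an inequality on all of \<open>K\<close>.\<close>

section \<open>Layer-cake formulas and inclusion-exclusion\<close>

lemma emeasure_lborel_initial_segment:
  "(\<integral>\<^sup>+t. indicator {t. 0 < t \<and> ennreal t \<le> a} t \<partial>lborel) = a"
proof (cases a)
  case (real r)
  then have "{t. 0 < t \<and> ennreal t \<le> a} = {0<..r}"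
    by (auto simp: ennreal_le_iff2)
  with real show ?thesis
    by (simp add: emeasure_lborel_Ioc)
next
  case top
  have "{t::real. 0 < t \<and> ennreal t \<le> top} = {0<..}" by auto
  moreover have "of_nat n \<le> emeasure lborel {0::real<..}" for n
    using emeasure_mono[of "{0<..real n}" "{0<..}" lborel]
    by (auto simp: ennreal_of_nat_eq_real_of_nat subset_eq)
  then have "emeasure lborel {0::real<..} = \<infinity>"
    by (metis ennreal_Ex_less_of_nat infinity_ennreal_def leD less_top)
  ultimately show ?thesis using top by simp
qed

lemma nn_integral_layer_cake:
  fixes u :: "'a \<Rightarrow> ennreal"
  assumes "sigma_finite_measure M" and [measurable]: "u \<in> borel_measurable M"
  shows "(\<integral>\<^sup>+x. u x \<partial>M)
    = (\<integral>\<^sup>+t. emeasure M {x\<in>space M. ennreal t \<le> u x} * indicator {0<..} t \<partial>lborel)"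
proof -
  interpret M: sigma_finite_measure M by fact
  interpret P: pair_sigma_finite M lborel ..
  have "(\<integral>\<^sup>+x. u x \<partial>M) = (\<integral>\<^sup>+x. \<integral>\<^sup>+t. indicator {t. 0 < t \<and> ennreal t \<le> u x} t \<partial>lborel \<partial>M)"
    by (simp add: emeasure_lborel_initial_segment del: nn_integral_indicator)
  also have "\<dots> = (\<integral>\<^sup>+x. \<integral>\<^sup>+t. indicator {x\<in>space M. ennreal t \<le> u x} x * indicator {0<..} t \<partial>lborel \<partial>M)"
    by (intro nn_integral_cong) (auto split: split_indicator)
  also have "\<dots> = (\<integral>\<^sup>+t. \<integral>\<^sup>+x. indicator {x\<in>space M. ennreal t \<le> u x} x * indicator {0<..} t \<partial>M \<partial>lborel)"
  proof (rule P.Fubini'[symmetric])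
    have "(\<lambda>(x, t). indicator {x \<in> space M. ennreal t \<le> u x} x * indicator {0<..} t :: ennreal)
       = (\<lambda>p. indicator {p\<in>space (M \<Otimes>\<^sub>M lborel). ennreal (snd p) \<le> u (fst p)} p * indicator {0<..} (snd p))"
      by (auto simp: space_pair_measure fun_eq_iff split: split_indicator)
    also have "\<dots> \<in> borel_measurable (M \<Otimes>\<^sub>M lborel)" by measurable
    finally show "(\<lambda>(x, t). indicator {x \<in> space M. ennreal t \<le> u x} x * indicator {0<..} t :: ennreal)
      \<in> borel_measurable (M \<Otimes>\<^sub>M lborel)" .
  qed
  also have "\<dots> = (\<integral>\<^sup>+t. emeasure M {x\<in>space M. ennreal t \<le> u x} * indicator {0<..} t \<partial>lborel)"
    by (intro nn_integral_cong) (subst nn_integral_multc, auto)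
  finally show ?thesis .
qed

text \<open>The strict form complements events \<open>\<phi> m \<le> t\<close>, as
  \<open>void_probability\<close> needs; the non-strict form serves reciprocals, where
  \<open>t \<le> inverse Y\<close> becomes \<open>Y \<le> 1 / t\<close>.\<close>

lemma nn_integral_layer_cake_strict:
  fixes u :: "'a \<Rightarrow> ennreal"
  assumes "sigma_finite_measure M" and [measurable]: "u \<in> borel_measurable M"
  shows "(\<integral>\<^sup>+x. u x \<partial>M)
    = (\<integral>\<^sup>+t. emeasure M {x\<in>space M. ennreal t < u x} * indicator {0<..} t \<partial>lborel)"
proof -
  interpret M: sigma_finite_measure M by fact
  interpret P: pair_sigma_finite M lborel ..
  \<comment> \<open>For fixed \<open>a\<close> the indicators differ at most at
    \<open>t = enn2real a\<close>.\<close>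
  have ae: "AE t in lborel. indicator {t. 0 < t \<and> ennreal t \<le> a} t = (indicator {t. 0 < t \<and> ennreal t < a} t :: ennreal)" for a
    using AE_lborel_singleton[of "enn2real a"]
    by eventually_elim (auto simp: le_less split: split_indicator)
  have "(\<integral>\<^sup>+x. u x \<partial>M) = (\<integral>\<^sup>+x. \<integral>\<^sup>+t. indicator {t. 0 < t \<and> ennreal t < u x} t \<partial>lborel \<partial>M)"
    by (simp add: emeasure_lborel_initial_segment flip: nn_integral_cong_AE[OF ae] del: nn_integral_indicator)
  also have "\<dots> = (\<integral>\<^sup>+x. \<integral>\<^sup>+t. indicator {x\<in>space M. ennreal t < u x} x * indicator {0<..} t \<partial>lborel \<partial>M)"
    by (intro nn_integral_cong) (auto split: split_indicator)
  also have "\<dots> = (\<integral>\<^sup>+t. \<integral>\<^sup>+x. indicator {x\<in>space M. ennreal t < u x} x * indicator {0<..} t \<partial>M \<partial>lborel)"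
  proof (rule P.Fubini'[symmetric])
    have "(\<lambda>(x, t). indicator {x \<in> space M. ennreal t < u x} x * indicator {0<..} t :: ennreal)
       = (\<lambda>p. indicator {p\<in>space (M \<Otimes>\<^sub>M lborel). ennreal (snd p) < u (fst p)} p * indicator {0<..} (snd p))"
      by (auto simp: space_pair_measure fun_eq_iff split: split_indicator)
    also have "\<dots> \<in> borel_measurable (M \<Otimes>\<^sub>M lborel)" by measurable
    finally show "(\<lambda>(x, t). indicator {x \<in> space M. ennreal t < u x} x * indicator {0<..} t :: ennreal)
      \<in> borel_measurable (M \<Otimes>\<^sub>M lborel)" .
  qed
  also have "\<dots> = (\<integral>\<^sup>+t. emeasure M {x\<in>space M. ennreal t < u x} * indicator {0<..} t \<partial>lborel)"
    by (intro nn_integral_cong) (subst nn_integral_multc, auto)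
  finally show ?thesis .
qed

text \<open>Inclusion-exclusion one set at a time: removing \<open>A z\<close> subtracts the part
  inside \<open>A z\<close>, which is the same expression with \<open>z\<close> moved into
  \<open>G\<close>. Hence \<open>G\<close> stays arbitrary in the induction.\<close>

lemma emeasure_Inter_Diff_Union_eq:
  assumes "finite_measure M" "finite_measure N" "finite F" "finite G"
    and A: "\<And>y. A y \<in> sets M" and B: "\<And>y. B y \<in> sets N"
    and eq: "\<And>G. finite G \<Longrightarrow>
      emeasure M (space M \<inter> (\<Inter>y\<in>G. A y)) = emeasure N (space N \<inter> (\<Inter>y\<in>G. B y))"
  shows "emeasure M (space M \<inter> (\<Inter>y\<in>G. A y) - (\<Union>y\<in>F. A y))
    = emeasure N (space N \<inter> (\<Inter>y\<in>G. B y) - (\<Union>y\<in>F. B y))"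
  using \<open>finite F\<close> \<open>finite G\<close>
proof (induction F arbitrary: G rule: finite_induct)
  case empty
  then show ?case by (simp add: eq)
next
  case (insert z F)
  interpret M: finite_measure M by fact
  interpret N: finite_measure N by fact
  have sets_M: "space M \<inter> (\<Inter>y\<in>G. A y) - (\<Union>y\<in>F. A y) \<in> sets M" if "finite G" for G
    using that insert(1) A by (induction G rule: finite_induct) (auto simp: Int_ac intro!: sets.Diff)
  have sets_N: "space N \<inter> (\<Inter>y\<in>G. B y) - (\<Union>y\<in>F. B y) \<in> sets N" if "finite G" for G
    using that insert(1) B by (induction G rule: finite_induct) (auto simp: Int_ac intro!: sets.Diff)
  have "emeasure M (space M \<inter> (\<Inter>y\<in>G. A y) - (\<Union>y\<in>insert z F. A y))
    = emeasure M ((space M \<inter> (\<Inter>y\<in>G. A y) - (\<Union>y\<in>F. A y))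
        - (space M \<inter> (\<Inter>y\<in>insert z G. A y) - (\<Union>y\<in>F. A y)))"
    by (rule arg_cong[where f="emeasure M"]) auto
  also have "\<dots> = emeasure M (space M \<inter> (\<Inter>y\<in>G. A y) - (\<Union>y\<in>F. A y))
      - emeasure M (space M \<inter> (\<Inter>y\<in>insert z G. A y) - (\<Union>y\<in>F. A y))"
    using insert.prems by (intro emeasure_Diff sets_M) auto
  also have "\<dots> = emeasure N (space N \<inter> (\<Inter>y\<in>G. B y) - (\<Union>y\<in>F. B y))
      - emeasure N (space N \<inter> (\<Inter>y\<in>insert z G. B y) - (\<Union>y\<in>F. B y))"
    using insert.IH[of G] insert.IH[of "insert z G"] insert.prems by simp
  also have "\<dots> = emeasure N ((space N \<inter> (\<Inter>y\<in>G. B y) - (\<Union>y\<in>F. B y))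
        - (space N \<inter> (\<Inter>y\<in>insert z G. B y) - (\<Union>y\<in>F. B y)))"
    using insert.prems by (intro emeasure_Diff[symmetric] sets_N) auto
  also have "\<dots> = emeasure N (space N \<inter> (\<Inter>y\<in>G. B y) - (\<Union>y\<in>insert z F. B y))"
    by (rule arg_cong[where f="emeasure N"]) auto
  finally show ?case .
qed

text \<open>For integrals in which the end of an interval is itself integrated over:
  \<open>indicator {0<..<s} u\<close> is later split into
  \<open>indicator {0<..} u * indicator {u<..} s\<close>.\<close>

lemma borel_measurable_indicator_Ioi [measurable (raw)]:
  fixes f g :: "'a \<Rightarrow> real"
  assumes [measurable]: "f \<in> borel_measurable M" "g \<in> borel_measurable M"
  shows "(\<lambda>x. indicator {f x<..} (g x) :: ennreal) \<in> borel_measurable M"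
proof -
  have "(\<lambda>x. indicator {f x<..} (g x) :: ennreal) = (\<lambda>x. if f x < g x then 1 else 0)"
    by (auto split: split_indicator)
  then show ?thesis by simp
qed

section \<open>Marked Poisson arrivals\<close>

definition expo :: "real measure" where
  "expo = density lborel (exponential_density 1)"

lemma sets_expo [measurable_cong, simp]: "sets expo = sets borel"
  by (simp add: expo_def)

lemma space_expo [simp]: "space expo = UNIV"
  by (simp add: expo_def)

lemma prob_space_expo: "prob_space expo"
  unfolding expo_def by (rule prob_space_exponential_density) simp

lemma nn_integral_expo:
  assumes [measurable]: "u \<in> borel_measurable borel"
  shows "(\<integral>\<^sup>+x. u x \<partial>expo) = (\<integral>\<^sup>+x. ennreal (exp (-x)) * u x * indicator {0<..} x \<partial>lborel)"
proof -
  have "(\<integral>\<^sup>+x. u x \<partial>expo) = (\<integral>\<^sup>+x. ennreal (exponential_density 1 x) * u x \<partial>lborel)"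
    unfolding expo_def by (subst nn_integral_density) auto
  also have "\<dots> = (\<integral>\<^sup>+x. ennreal (exp (-x)) * u x * indicator {0<..} x \<partial>lborel)"
    using AE_lborel_singleton[of 0]
    by (intro nn_integral_cong_AE, eventually_elim)
       (auto simp: exponential_density_def split: split_indicator)
  finally show ?thesis .
qed

lemma AE_expo_pos: "AE x in expo. 0 < x"
  unfolding expo_def
  using AE_lborel_singleton[of 0]
  by (subst AE_density) (auto simp: exponential_density_def elim: eventually_mono)

text \<open>Streams hold gaps rather than arrival times, so that the pairs of gap and mark are
  i.i.d. and \<open>stream_space\<close> applies. Counting starts at 0: \<open>arrival X i\<close>
  is the sum of the first \<open>i + 1\<close> gaps.\<close>

definition arrival :: "(real \<times> 'b) stream \<Rightarrow> nat \<Rightarrow> real" where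
  "arrival X i = (\<Sum>j\<le>i. fst (X !! j))"

lemma arrival_0 [simp]: "arrival X 0 = fst (shd X)"
  by (simp add: arrival_def)

lemma arrival_Suc_shift: "arrival X (Suc i) = fst (shd X) + arrival (stl X) i"
  unfolding arrival_def by (subst sum.atMost_Suc_shift) simp

text \<open>Deletion of point \<open>i\<close> in terms of gaps: the gaps on both sides of it are
  fused, so that later points keep their times, and the fused gap carries the mark of the next
  point.\<close>

primrec merge_at :: "nat \<Rightarrow> (real \<times> 'b) stream \<Rightarrow> (real \<times> 'b) stream" where
  "merge_at 0 X = (fst (shd X) + fst (shd (stl X)), snd (shd (stl X))) ## stl (stl X)"
| "merge_at (Suc i) X = shd X ## merge_at i (stl X)"

lemma snd_merge_at: "snd (merge_at i X !! j) = snd (X !! (if j < i then j else Suc j))"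
  by (induction i arbitrary: X j) (auto simp: Stream_snth split: nat.split)

lemma arrival_merge_at: "arrival (merge_at i X) j = arrival X (if j < i then j else Suc j)"
proof (induction i arbitrary: X j)
  case 0
  show ?case
    by (cases j) (auto simp: arrival_Suc_shift)
next
  case (Suc i)
  show ?case
    by (cases j) (auto simp: arrival_Suc_shift Suc.IH)
qed

lemma arrival_eq_pred: "arrival X i = (\<Sum>j<i. fst (X !! j)) + fst (X !! i)"
  by (simp add: arrival_def lessThan_Suc_atMost[symmetric])

text \<open>After the deletion the time of the deleted point can still be read off: the first
  \<open>i\<close> gaps of the merged stream plus the number \<open>fst (X !! i)\<close>.\<close>

lemma sum_fst_merge_at: "j \<le> i \<Longrightarrow> (\<Sum>k<j. fst (merge_at i X !! k)) = (\<Sum>k<j. fst (X !! k))"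
proof (induction i arbitrary: X j)
  case (Suc i)
  then show ?case
    by (cases j) (auto simp del: sum.lessThan_Suc simp: sum.lessThan_Suc_shift)
qed auto

locale marked_arrivals = prob_space Q for Q :: "'b measure"
begin

abbreviation D where "D \<equiv> expo \<Otimes>\<^sub>M Q"
abbreviation S where "S \<equiv> stream_space D"

lemma prob_space_D: "prob_space D"
  by (rule prob_space_pair[OF prob_space_expo prob_space_axioms])

lemma prob_space_S: "prob_space S"
  using prob_space_D by (rule prob_space.prob_space_stream_space)

lemma measurable_arrival [measurable]: "(\<lambda>X. arrival X i) \<in> borel_measurable S"
  unfolding arrival_def by measurable

lemma measurable_merge_at [measurable]: "merge_at i \<in> measurable S S"
proof (induction i)
  case 0
  show ?case unfolding merge_at.simps[abs_def] by measurable
next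
  case (Suc i)
  note Suc [measurable]
  show ?case unfolding merge_at.simps[abs_def] by measurable
qed

lemma nn_integral_D:
  assumes [measurable]: "u \<in> borel_measurable D"
  shows "(\<integral>\<^sup>+p. u p \<partial>D)
    = (\<integral>\<^sup>+x. ennreal (exp (-x)) * (\<integral>\<^sup>+m. u (x, m) \<partial>Q) * indicator {0<..} x \<partial>lborel)"
proof -
  interpret e: prob_space expo by (rule prob_space_expo)
  interpret P: pair_sigma_finite expo Q ..
  have "(\<integral>\<^sup>+p. u p \<partial>D) = (\<integral>\<^sup>+x. (\<integral>\<^sup>+m. u (x, m) \<partial>Q) \<partial>expo)"
    by (simp add: nn_integral_fst)
  also have "\<dots> = (\<integral>\<^sup>+x. ennreal (exp (-x)) * (\<integral>\<^sup>+m. u (x, m) \<partial>Q) * indicator {0<..} x \<partial>lborel)"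
    by (rule nn_integral_expo) measurable
  finally show ?thesis .
qed

lemma nn_integral_S:
  assumes "u \<in> borel_measurable S"
  shows "(\<integral>\<^sup>+X. u X \<partial>S) = (\<integral>\<^sup>+p. \<integral>\<^sup>+X. u (p ## X) \<partial>S \<partial>D)"
  using prob_space.nn_integral_stream_space[OF prob_space_D assms] .

text \<open>Mecke's formula for a single arrival: deleting the \<open>i\<close>-th arrival from a Poisson
  process merges two exponential gaps into one gap of Gamma law, in which the deleted point is
  uniform.\<close>

lemma nn_integral_merge_at:
  assumes h: "(\<lambda>(X, u). h X u) \<in> borel_measurable (S \<Otimes>\<^sub>M borel)"
  shows "(\<integral>\<^sup>+X. h (merge_at i X) (fst (X !! i)) \<partial>S)
    = (\<integral>\<^sup>+X. \<integral>\<^sup>+u. h X u * indicator {0<..<fst (X !! i)} u \<partial>lborel \<partial>S)"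
  using h
proof (induction i arbitrary: h)
  case 0
  note 0 [measurable]
  interpret S: prob_space S by (rule prob_space_S)
  interpret D: prob_space D by (rule prob_space_D)
  interpret SL: pair_sigma_finite S lborel ..
  interpret QL: pair_sigma_finite Q lborel ..
  have h' [measurable (raw)]: "(\<lambda>x. h (F x) (G x)) \<in> borel_measurable L"
    if "F \<in> measurable L S" "G \<in> borel_measurable L" for F G and L :: "'l measure"
    using measurable_compose[OF measurable_Pair[OF that] 0] by simp
  \<comment> \<open>\<open>k s a\<close> averages over the mark of the fused gap \<open>s\<close>
    and the rest of the stream, with the deleted point at \<open>a\<close>. The mark of the deleted
    point does not occur and integrates out.\<close>
  define k where "k s a = (\<integral>\<^sup>+m. \<integral>\<^sup>+X. h ((s, m) ## X) a \<partial>S \<partial>Q)" for s a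
  have k_meas [measurable (raw)]: "(\<lambda>x. k (F x) (G x)) \<in> borel_measurable L"
    if [measurable]: "F \<in> borel_measurable L" "G \<in> borel_measurable L" for F G and L :: "'l measure"
    unfolding k_def by measurable
  have exp_add_uminus: "exp (- (x + y)) = exp (- x) * exp (- y)" for x y :: real
    by (simp flip: exp_add)
  have ind [simp]: "indicator {0<..<s} u = (indicator {0<..} u * indicator {u<..} s :: ennreal)" for s u :: real
    by (auto split: split_indicator)
  have "(\<integral>\<^sup>+X. h (merge_at 0 X) (fst (X !! 0)) \<partial>S)
      = (\<integral>\<^sup>+p. \<integral>\<^sup>+p'. \<integral>\<^sup>+X. h ((fst p + fst p', snd p') ## X) (fst p) \<partial>S \<partial>D \<partial>D)"
    by (subst nn_integral_S, simp, intro nn_integral_cong, subst nn_integral_S) simp_all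
  also have "\<dots> = (\<integral>\<^sup>+a. ennreal (exp (-a)) *
      (\<integral>\<^sup>+p'. \<integral>\<^sup>+X. h ((a + fst p', snd p') ## X) a \<partial>S \<partial>D) * indicator {0<..} a \<partial>lborel)"
    by (subst nn_integral_D) (simp_all add: emeasure_space_1)
  also have "\<dots> = (\<integral>\<^sup>+a. ennreal (exp (-a)) *
      (\<integral>\<^sup>+b. ennreal (exp (-b)) * k (a + b) a * indicator {0<..} b \<partial>lborel) * indicator {0<..} a \<partial>lborel)"
    by (subst nn_integral_D) (simp_all add: k_def)
  \<comment> \<open>Preparation for \<open>s = a + b\<close>: the joint density becomes
    \<open>exp (- s)\<close>, free of \<open>a\<close>, and \<open>0 < b\<close> becomes
    \<open>a < s\<close>, so that \<open>a\<close> is uniform given \<open>s\<close>.\<close>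
  also have "\<dots> = (\<integral>\<^sup>+a. (\<integral>\<^sup>+b. ennreal (exp (-(a + b))) * k (a + b) a * indicator {a<..} (a + b)
      * indicator {0<..} a \<partial>lborel) \<partial>lborel)"
    apply (rule nn_integral_cong)
    apply (subst nn_integral_cmult[symmetric])
     apply measurable
    apply (subst nn_integral_multc[symmetric])
     apply measurable
    apply (rule nn_integral_cong)
    apply (auto simp: exp_add_uminus ennreal_mult mult_ac simp del: minus_add_distrib split: split_indicator)
    done
  also have "\<dots> = (\<integral>\<^sup>+a. (\<integral>\<^sup>+s. ennreal (exp (-s)) * k s a * indicator {a<..} s
      * indicator {0<..} a \<partial>lborel) \<partial>lborel)"
  proof (rule nn_integral_cong)
    fix a :: real
    show "(\<integral>\<^sup>+b. ennreal (exp (-(a + b))) * k (a + b) a * indicator {a<..} (a + b)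
      * indicator {0<..} a \<partial>lborel) = (\<integral>\<^sup>+s. ennreal (exp (-s)) * k s a * indicator {a<..} s
      * indicator {0<..} a \<partial>lborel)"
      by (subst (2) nn_integral_real_affine[where c=1 and t=a]) auto
  qed
  also have "\<dots> = (\<integral>\<^sup>+s. (\<integral>\<^sup>+a. ennreal (exp (-s)) * k s a * indicator {a<..} s
      * indicator {0<..} a \<partial>lborel) \<partial>lborel)"
    by (rule lborel_pair.Fubini') measurable
  also have "\<dots> = (\<integral>\<^sup>+s. ennreal (exp (-s)) *
      (\<integral>\<^sup>+a. k s a * indicator {0<..<s} a \<partial>lborel) * indicator {0<..} s \<partial>lborel)"
    apply (rule nn_integral_cong)
    apply (subst nn_integral_cmult[symmetric])
     apply measurable
    apply (subst nn_integral_multc[symmetric])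
     apply measurable
    apply (rule nn_integral_cong)
    apply (auto split: split_indicator)
    done
  also have "\<dots> = (\<integral>\<^sup>+s. ennreal (exp (-s)) *
      (\<integral>\<^sup>+m. \<integral>\<^sup>+X. \<integral>\<^sup>+a. h ((s, m) ## X) a * indicator {0<..<s} a \<partial>lborel \<partial>S \<partial>Q)
        * indicator {0<..} s \<partial>lborel)"
  proof (intro nn_integral_cong arg_cong2[where f="(*)"] refl)
    fix s :: real
    have "(\<integral>\<^sup>+a. k s a * indicator {0<..<s} a \<partial>lborel)
      = (\<integral>\<^sup>+a. \<integral>\<^sup>+m. \<integral>\<^sup>+X. h ((s, m) ## X) a * indicator {0<..<s} a \<partial>S \<partial>Q \<partial>lborel)"
      unfolding k_def
      by (intro nn_integral_cong, subst nn_integral_multc[symmetric], measurable)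
         (intro nn_integral_cong, subst nn_integral_multc[symmetric], auto)
    also have "\<dots> = (\<integral>\<^sup>+m. \<integral>\<^sup>+a. \<integral>\<^sup>+X. h ((s, m) ## X) a * indicator {0<..<s} a \<partial>S \<partial>lborel \<partial>Q)"
      by (rule QL.Fubini') measurable
    also have "\<dots> = (\<integral>\<^sup>+m. \<integral>\<^sup>+X. \<integral>\<^sup>+a. h ((s, m) ## X) a * indicator {0<..<s} a \<partial>lborel \<partial>S \<partial>Q)"
      by (intro nn_integral_cong SL.Fubini') measurable
    finally show "(\<integral>\<^sup>+a. k s a * indicator {0<..<s} a \<partial>lborel)
      = (\<integral>\<^sup>+m. \<integral>\<^sup>+X. \<integral>\<^sup>+a. h ((s, m) ## X) a * indicator {0<..<s} a \<partial>lborel \<partial>S \<partial>Q)" .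
  qed
  also have "\<dots> = (\<integral>\<^sup>+X. \<integral>\<^sup>+u. h X u * indicator {0<..<fst (X !! 0)} u \<partial>lborel \<partial>S)"
    by (subst nn_integral_S, simp, measurable) (subst nn_integral_D, simp_all)
  finally show ?case .
next
  case (Suc i)
  note Suc.prems [measurable]
  have h' [measurable (raw)]: "(\<lambda>x. h (F x) (G x)) \<in> borel_measurable L"
    if "F \<in> measurable L S" "G \<in> borel_measurable L" for F G and L :: "'l measure"
    using measurable_compose[OF measurable_Pair[OF that] Suc.prems] by simp
  have ind: "indicator {0<..<s} u = (indicator {0<..} u * indicator {u<..} s :: ennreal)" for s u :: real
    by (auto split: split_indicator)
  have "(\<integral>\<^sup>+X. h (merge_at (Suc i) X) (fst (X !! Suc i)) \<partial>S)
    = (\<integral>\<^sup>+p. \<integral>\<^sup>+X. h (p ## merge_at i X) (fst (X !! i)) \<partial>S \<partial>D)"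
    by (subst nn_integral_S) (simp_all, measurable)
  \<comment> \<open>Merging further on leaves the first entry alone, so the induction hypothesis
    applies to \<open>h\<close> with that entry \<open>p\<close> fixed.\<close>
  also have "\<dots> = (\<integral>\<^sup>+p. \<integral>\<^sup>+X. \<integral>\<^sup>+u. h (p ## X) u * indicator {0<..<fst (X !! i)} u \<partial>lborel \<partial>S \<partial>D)"
  proof (rule nn_integral_cong)
    fix p assume [measurable]: "p \<in> space D"
    show "(\<integral>\<^sup>+X. h (p ## merge_at i X) (fst (X !! i)) \<partial>S)
      = (\<integral>\<^sup>+X. \<integral>\<^sup>+u. h (p ## X) u * indicator {0<..<fst (X !! i)} u \<partial>lborel \<partial>S)"
      by (rule Suc.IH) measurable
  qed
  also have "\<dots> = (\<integral>\<^sup>+X. \<integral>\<^sup>+u. h X u * indicator {0<..<fst (X !! Suc i)} u \<partial>lborel \<partial>S)"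
    unfolding ind by (subst nn_integral_S) (simp_all)
  finally show ?case .
qed

end

section \<open>Counting arrivals below a random level; void probabilities\<close>

text \<open>Difference quotients are at most \<open>\<bar>C\<bar> * \<bar>y - x\<bar>\<close>, so
  the derivative exists and vanishes without any prior regularity of \<open>F\<close>.\<close>

lemma constant_if_quadratically_close:
  fixes F :: "real \<Rightarrow> real"
  assumes "\<And>x y. a \<le> x \<Longrightarrow> x \<le> y \<Longrightarrow> y \<le> b \<Longrightarrow> \<bar>F x - F y\<bar> \<le> C * (y - x)\<^sup>2" and "a \<le> b"
  shows "F a = F b"
proof -
  have F: "\<bar>F y - F x\<bar> \<le> C * (y - x)\<^sup>2" if "x \<in> {a..b}" "y \<in> {a..b}" for x y
    using assms(1)[of x y] assms(1)[of y x] that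
    by (cases "x \<le> y") (auto simp: abs_minus_commute power2_commute)
  have "(F has_field_derivative 0) (at x within {a..b})" if x: "x \<in> {a..b}" for x
    unfolding has_field_derivative_iff
  proof (rule Lim_null_comparison)
    show "\<forall>\<^sub>F y in at x within {a..b}. norm ((F y - F x) / (y - x)) \<le> \<bar>C\<bar> * \<bar>y - x\<bar>"
    proof (subst eventually_at, intro exI[of _ 1] conjI ballI impI)
      fix y assume y: "y \<in> {a..b}" "y \<noteq> x \<and> dist y x < 1"
      have "\<bar>F y - F x\<bar> \<le> \<bar>C\<bar> * (y - x)\<^sup>2"
        using F[OF x y(1)] mult_right_mono[of C "\<bar>C\<bar>" "(y - x)\<^sup>2"] zero_le_power2[of "y - x"]
          abs_ge_self[of C] by linarith
      then show "norm ((F y - F x) / (y - x)) \<le> \<bar>C\<bar> * \<bar>y - x\<bar>"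
        using y by (auto simp: divide_le_eq power2_eq_square abs_mult mult.assoc)
    qed simp
    show "((\<lambda>y. \<bar>C\<bar> * \<bar>y - x\<bar>) \<longlongrightarrow> 0) (at x within {a..b})"
      by (auto intro!: tendsto_eq_intros)
  qed
  then obtain k where "\<And>x. x \<in> {a..b} \<Longrightarrow> F x = k"
    using has_field_derivative_zero_constant[of "{a..b}" F] by auto
  then show ?thesis using \<open>a \<le> b\<close> by simp
qed

lemma arrival_pos:
  assumes "\<And>i. 0 < fst (X !! i)"
  shows "0 < arrival X i"
  unfolding arrival_def using assms by (intro sum_pos) auto

text \<open>The \<open>i\<close>-th integral is the length of the part of the \<open>i\<close>-th
  gap interval below \<open>a\<close>. These intervals are disjoint, and the whole positive
  half-line up to \<open>a\<close> has length \<open>a\<close>.\<close>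

lemma sum_gap_lengths_le:
  fixes X :: "(real \<times> 'b) stream" and a :: ennreal
  assumes pos: "\<And>i. 0 < fst (X !! i)"
  shows "(\<Sum>i<n. \<integral>\<^sup>+u. (if ennreal ((\<Sum>j<i. fst (X !! j)) + u) \<le> a then 1 else 0)
      * indicator {0<..<fst (X !! i)} u \<partial>lborel) \<le> a"
proof -
  define pre where "pre i = (\<Sum>j<i. fst (X !! j))" for i
  have pre0: "0 \<le> pre i" for i
    unfolding pre_def using pos by (intro sum_nonneg less_imp_le)
  have pre_Suc: "pre (Suc i) = pre i + fst (X !! i)" for i
    by (simp add: pre_def)
  have "(\<Sum>i<n. \<integral>\<^sup>+u. (if ennreal (pre i + u) \<le> a then 1 else 0)
      * indicator {0<..<fst (X !! i)} u \<partial>lborel)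
      \<le> (\<integral>\<^sup>+t. (if ennreal t \<le> a then 1 else 0) * indicator {0<..<pre n} t \<partial>lborel)"
  proof (induction n)
    case (Suc n)
    have "(\<integral>\<^sup>+u. (if ennreal (pre n + u) \<le> a then 1 else 0) * indicator {0<..<fst (X !! n)} u \<partial>lborel)
      = (\<integral>\<^sup>+t. (if ennreal t \<le> a then 1 else 0) * indicator {pre n<..<pre (Suc n)} t \<partial>lborel)"
      by (subst (2) nn_integral_real_affine[where c=1 and t="pre n"])
         (auto simp: pre_Suc intro!: nn_integral_cong split: split_indicator)
    with Suc have "(\<Sum>i<Suc n. \<integral>\<^sup>+u. (if ennreal (pre i + u) \<le> a then 1 else 0)
        * indicator {0<..<fst (X !! i)} u \<partial>lborel)
      \<le> (\<integral>\<^sup>+t. (if ennreal t \<le> a then 1 else 0) * indicator {0<..<pre n} t \<partial>lborel)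
        + (\<integral>\<^sup>+t. (if ennreal t \<le> a then 1 else 0) * indicator {pre n<..<pre (Suc n)} t \<partial>lborel)"
      by (simp add: add_right_mono)
    also have "\<dots> = (\<integral>\<^sup>+t. (if ennreal t \<le> a then 1 else 0) * indicator {0<..<pre n} t
        + (if ennreal t \<le> a then 1 else 0) * indicator {pre n<..<pre (Suc n)} t \<partial>lborel)"
      by (rule nn_integral_add[symmetric]) auto
    also have "\<dots> \<le> (\<integral>\<^sup>+t. (if ennreal t \<le> a then 1 else 0) * indicator {0<..<pre (Suc n)} t \<partial>lborel)"
      using pos[of n] pre0[of n] by (intro nn_integral_mono) (auto simp: pre_Suc split: split_indicator)
    finally show ?case .
  qed simp
  also have "\<dots> \<le> (\<integral>\<^sup>+t. indicator {t. 0 < t \<and> ennreal t \<le> a} t \<partial>lborel)"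
    by (intro nn_integral_mono) (auto split: split_indicator)
  also have "\<dots> = a" by (rule emeasure_lborel_initial_segment)
  finally show ?thesis by (simp add: pre_def)
qed

context marked_arrivals
begin

lemma AE_S_pos: "AE X in S. \<forall>i. 0 < fst (X !! i)"
proof -
  interpret e: prob_space expo by (rule prob_space_expo)
  interpret P: pair_sigma_finite expo Q ..
  have "AE p in D. 0 < fst p"
    by (rule P.AE_pair_measure) (measurable, use AE_expo_pos in simp)
  then show ?thesis
    using prob_space.AE_stream_all[OF prob_space_D, of "\<lambda>p. 0 < fst p"]
    by (simp add: sset_range)
qed

text \<open>The level is first raised to its value \<open>a (merge_at i X)\<close> after deletion.
  Mecke's formula then turns the probability that point \<open>i\<close> is counted into the
  expected length of a piece of a gap, and \<open>sum_gap_lengths_le\<close> adds the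
  pieces.\<close>

lemma expected_arrivals_before_le:
  assumes a [measurable]: "a \<in> borel_measurable S"
    and mono: "\<And>X i. X \<in> space S \<Longrightarrow> a X \<le> a (merge_at i X)"
  shows "(\<integral>\<^sup>+X. (\<Sum>i. if ennreal (arrival X i) \<le> a X then 1 else 0) \<partial>S) \<le> (\<integral>\<^sup>+X. a X \<partial>S)"
proof -
  \<comment> \<open>The stream argument is the one without the point, and \<open>u\<close> is the
    position of the point inside the fused gap.\<close>
  define h where "h i X u = (if ennreal ((\<Sum>j<i. fst (X !! j)) + u) \<le> a X then 1 else 0 :: ennreal)"
    for i and X :: "(real \<times> 'b) stream" and u :: real
  have h_meas [measurable]: "(\<lambda>(X, u). h i X u) \<in> borel_measurable (S \<Otimes>\<^sub>M borel)" for i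
    unfolding h_def by measurable
  have "(\<integral>\<^sup>+X. (\<Sum>i. if ennreal (arrival X i) \<le> a X then 1 else 0) \<partial>S)
      = (\<Sum>i. \<integral>\<^sup>+X. (if ennreal (arrival X i) \<le> a X then 1 else 0) \<partial>S)"
    by (rule nn_integral_suminf) measurable
  also have "\<dots> \<le> (\<Sum>i. \<integral>\<^sup>+X. h i (merge_at i X) (fst (X !! i)) \<partial>S)"
    using mono by (intro suminf_le nn_integral_mono) 
      (auto simp: h_def sum_fst_merge_at arrival_eq_pred intro: order_trans)
  also have "\<dots> = (\<Sum>i. \<integral>\<^sup>+X. \<integral>\<^sup>+u. h i X u * indicator {0<..<fst (X !! i)} u \<partial>lborel \<partial>S)"
    by (simp only: nn_integral_merge_at[OF h_meas])
  also have "\<dots> = (\<integral>\<^sup>+X. (\<Sum>i. \<integral>\<^sup>+u. h i X u * indicator {0<..<fst (X !! i)} u \<partial>lborel) \<partial>S)"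
  proof (rule nn_integral_suminf[symmetric])
    fix i
    have ind: "indicator {0<..<s} u = (indicator {0<..} u * indicator {u<..} s :: ennreal)" for s u :: real
      by (auto split: split_indicator)
    show "(\<lambda>X. \<integral>\<^sup>+u. h i X u * indicator {0<..<fst (X !! i)} u \<partial>lborel) \<in> borel_measurable S"
      unfolding ind h_def by measurable
  qed
  also have "\<dots> \<le> (\<integral>\<^sup>+X. a X \<partial>S)"
  proof (rule nn_integral_mono_AE)
    show "AE X in S. (\<Sum>i. \<integral>\<^sup>+u. h i X u * indicator {0<..<fst (X !! i)} u \<partial>lborel) \<le> a X"
      using AE_S_pos
      by eventually_elim (intro suminf_le_const summableI, auto simp: h_def intro: sum_gap_lengths_le)
  qed
  finally show ?thesis .
qed

lemma void_probability:
  fixes \<phi> :: "'b \<Rightarrow> ennreal"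
  assumes \<phi> [measurable]: "\<phi> \<in> borel_measurable Q"
    and bound: "\<And>m. m \<in> space Q \<Longrightarrow> \<phi> m \<le> ennreal b" and "0 \<le> b"
  shows "emeasure S {X\<in>space S. \<forall>i. \<phi> (snd (X !! i)) \<le> ennreal (arrival X i)}
    = ennreal (exp (- enn2real (\<integral>\<^sup>+m. \<phi> m \<partial>Q)))"
proof -
  interpret S: prob_space S by (rule prob_space_S)
  interpret D: prob_space D by (rule prob_space_D)
  txt \<open>With \<open>p t = Q {\<phi> \<le> t}\<close> and \<open>v x\<close> the probability that the arrivals shifted by \<open>x\<close> stay above
    the marks, \<open>w x = exp (-x) * v x\<close> solves \<open>w x = \<integral>\<^sub>x\<^sup>\<infinity> p t * w t dt\<close>, so that
    \<open>w x * exp (\<integral>\<^sub>0\<^sup>x p t dt)\<close> should be constant. As \<open>p\<close> need not be continuous, this is not derived from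
    the fundamental theorem of calculus but from an increment of order \<open>(y - x)\<^sup>2\<close>.\<close>
  define pe where "pe t = emeasure Q {m\<in>space Q. \<phi> m \<le> ennreal t}" for t
  define I where "I t X = (if \<forall>i. \<phi> (snd (X !! i)) \<le> ennreal (t + arrival X i) then 1 else 0 :: ennreal)"
    for t X
  define ve where "ve t = (\<integral>\<^sup>+X. I t X \<partial>S)" for t
  define W where "W t = ennreal (exp (- t)) * ve t" for t
  have I_meas [measurable (raw)]: "(\<lambda>x. I (F x) (G x)) \<in> borel_measurable L"
    if [measurable]: "F \<in> borel_measurable L" "G \<in> measurable L S" for F G and L :: "'l measure"
    unfolding I_def by measurable
  have ve_meas [measurable]: "ve \<in> borel_measurable borel"
    unfolding ve_def by measurable
  have W_meas [measurable]: "W \<in> borel_measurable borel"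
    unfolding W_def by measurable
  have pe_eq: "pe t = (\<integral>\<^sup>+m. (if \<phi> m \<le> ennreal t then 1 else 0) \<partial>Q)" for t
  proof -
    have "pe t = (\<integral>\<^sup>+m. indicator {m\<in>space Q. \<phi> m \<le> ennreal t} m \<partial>Q)"
      unfolding pe_def by simp
    also have "\<dots> = (\<integral>\<^sup>+m. (if \<phi> m \<le> ennreal t then 1 else 0) \<partial>Q)"
      by (intro nn_integral_cong) (simp add: indicator_def)
    finally show ?thesis .
  qed
  have pe_meas [measurable]: "pe \<in> borel_measurable borel"
    unfolding pe_eq[abs_def] by measurable
  have pe_le: "pe t \<le> 1" for t
    unfolding pe_def by (rule measure_le_1) 
  have all_nat: "(\<forall>i. P i) \<longleftrightarrow> P 0 \<and> (\<forall>i. P (Suc i))" for P :: "nat \<Rightarrow> bool"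
    by (metis not0_implies_Suc)
  \<comment> \<open>Renewal at the first point: the later points face the same constraints with time
    advanced by the first gap.\<close>
  have I_Stream: "I t ((u, m) ## X) = (if \<phi> m \<le> ennreal (t + u) then 1 else 0) * I (t + u) X" for t u m X
  proof -
    have "(\<forall>i. \<phi> (snd (((u, m) ## X) !! i)) \<le> ennreal (t + arrival ((u, m) ## X) i))
      \<longleftrightarrow> \<phi> m \<le> ennreal (t + u) \<and> (\<forall>i. \<phi> (snd (X !! i)) \<le> ennreal (t + u + arrival X i))"
      by (subst all_nat) (simp add: arrival_Suc_shift add.assoc)
    then show ?thesis by (simp add: I_def)
  qed
  have ve_eq: "ve x = (\<integral>\<^sup>+u. ennreal (exp (- u)) * (pe (x + u) * ve (x + u)) * indicator {0<..} u \<partial>lborel)" for x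
  proof -
    have "ve x = (\<integral>\<^sup>+p. \<integral>\<^sup>+X. I x (p ## X) \<partial>S \<partial>D)"
      unfolding ve_def by (rule nn_integral_S) measurable
    also have "\<dots> = (\<integral>\<^sup>+p. (if \<phi> (snd p) \<le> ennreal (x + fst p) then 1 else 0) * ve (x + fst p) \<partial>D)"
      unfolding ve_def
      by (rule nn_integral_cong, subst nn_integral_cmult[symmetric])
         (auto intro!: nn_integral_cong simp: I_Stream)
    also have "\<dots> = (\<integral>\<^sup>+u. ennreal (exp (- u)) * (pe (x + u) * ve (x + u)) * indicator {0<..} u \<partial>lborel)"
      by (subst nn_integral_D) (simp_all add: pe_eq nn_integral_multc)
    finally show ?thesis .
  qed
  \<comment> \<open>The factor \<open>exp (- x)\<close> absorbs the shift:
    \<open>exp (- x) * exp (- u)\<close> is \<open>exp (- t)\<close> at \<open>t = x + u\<close>, so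
    \<open>x\<close> survives only as the lower limit.\<close>
  have W_eq: "W x = (\<integral>\<^sup>+t. pe t * W t * indicator {x<..} t \<partial>lborel)" for x
  proof -
    have "W x = (\<integral>\<^sup>+u. ennreal (exp (- x)) *
        (ennreal (exp (- u)) * (pe (x + u) * ve (x + u)) * indicator {0<..} u) \<partial>lborel)"
      unfolding W_def by (subst ve_eq, subst nn_integral_cmult) auto
    also have "\<dots> = (\<integral>\<^sup>+u. pe (x + u) * W (x + u) * indicator {x<..} (x + u) \<partial>lborel)"
    proof (intro nn_integral_cong)
      fix u :: real
      have "ennreal (exp (- (x + u))) = ennreal (exp (- x)) * ennreal (exp (- u))"
        by (simp flip: ennreal_mult' exp_add)
      then show "ennreal (exp (- x)) *
        (ennreal (exp (- u)) * (pe (x + u) * ve (x + u)) * indicator {0<..} u)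
        = pe (x + u) * W (x + u) * indicator {x<..} (x + u)"
        by (auto simp: W_def mult_ac simp del: minus_add_distrib split: split_indicator)
    qed
    also have "\<dots> = (\<integral>\<^sup>+t. pe t * W t * indicator {x<..} t \<partial>lborel)"
      by (subst (2) nn_integral_real_affine[where c=1 and t=x]) auto
    finally show ?thesis .
  qed
  have ve_le: "ve x \<le> 1" for x
  proof -
    have "ve x \<le> (\<integral>\<^sup>+X. 1 \<partial>S)"
      unfolding ve_def by (intro nn_integral_mono) (auto simp: I_def)
    then show ?thesis by (simp add: S.emeasure_space_1)
  qed
  have W_antimono: "W y \<le> W x" if "x \<le> y" for x y
    unfolding W_eq[of x] W_eq[of y] using that
    by (intro nn_integral_mono) (auto split: split_indicator)
  define Pe where "Pe x y = (\<integral>\<^sup>+t. pe t * indicator {x<..y} t \<partial>lborel)" for x y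
  have Pe_add: "Pe x z = Pe x y + Pe y z" if "x \<le> y" "y \<le> z" for x y z
    unfolding Pe_def using that
    by (subst nn_integral_add[symmetric]) (auto intro!: nn_integral_cong split: split_indicator)
  have Pe_le: "Pe x y \<le> ennreal (y - x)" if "x \<le> y" for x y
  proof -
    have "Pe x y \<le> (\<integral>\<^sup>+t. indicator {x<..y} t \<partial>lborel)"
      unfolding Pe_def using pe_le by (intro nn_integral_mono) (auto split: split_indicator)
    with that show ?thesis by simp
  qed
  have W_split: "W x = W y + (\<integral>\<^sup>+t. pe t * W t * indicator {x<..y} t \<partial>lborel)" if "x \<le> y" for x y
    unfolding W_eq[of x] W_eq[of y] using that
    by (subst nn_integral_add[symmetric]) (auto intro!: nn_integral_cong split: split_indicator)
  \<comment> \<open>On \<open>{x<..y}\<close> the decreasing \<open>W\<close> lies between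
    \<open>W y\<close> and \<open>W x\<close>; this bounds the increment from both sides in terms of
    \<open>Pe x y\<close>.\<close>
  have W_lower: "W y + W y * Pe x y \<le> W x" if "x \<le> y" for x y
  proof -
    have "W y * Pe x y = (\<integral>\<^sup>+t. W y * (pe t * indicator {x<..y} t) \<partial>lborel)"
      unfolding Pe_def by (rule nn_integral_cmult[symmetric]) auto
    also have "\<dots> \<le> (\<integral>\<^sup>+t. pe t * W t * indicator {x<..y} t \<partial>lborel)"
      using W_antimono by (intro nn_integral_mono) (auto simp: mult_ac intro!: mult_mono split: split_indicator)
    finally show ?thesis
      unfolding W_split[OF that] by (rule add_left_mono)
  qed
  have W_upper: "W x \<le> W y + W x * Pe x y" if "x \<le> y" for x y
  proof -
    have "(\<integral>\<^sup>+t. pe t * W t * indicator {x<..y} t \<partial>lborel) \<le> (\<integral>\<^sup>+t. W x * (pe t * indicator {x<..y} t) \<partial>lborel)"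
      using W_antimono by (intro nn_integral_mono) (auto simp: mult_ac intro!: mult_mono split: split_indicator)
    also have "\<dots> = W x * Pe x y"
      unfolding Pe_def by (rule nn_integral_cmult) auto
    finally show ?thesis
      by (subst W_split[OF that]) (rule add_left_mono)
  qed
  define w where "w x = enn2real (W x)" for x
  define A where "A x = enn2real (Pe 0 x)" for x
  have W_w: "W x = ennreal (w x)" and w0: "0 \<le> w x" for x
  proof -
    have "W x \<le> ennreal (exp (- x)) * 1"
      unfolding W_def by (intro mult_left_mono ve_le) simp
    then have "W x < top" by (simp add: le_less_trans)
    then show "W x = ennreal (w x)" "0 \<le> w x" by (auto simp: w_def)
  qed
  have w1: "w x \<le> 1" if "0 \<le> x" for x
  proof -
    have "W x \<le> 1 * 1"
      unfolding W_def using that by (intro mult_mono ve_le) auto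
    then show ?thesis using w0 by (simp add: W_w)
  qed
  have Pe_A: "Pe x y = ennreal (A y - A x)" "0 \<le> A y - A x" "A y - A x \<le> y - x"
    if "0 \<le> x" "x \<le> y" for x y
  proof -
    have fin: "Pe 0 y < top" "Pe 0 x < top" "Pe x y < top"
      using Pe_le[of 0 y] Pe_le[of 0 x] Pe_le[of x y] that by (auto intro: le_less_trans)
    then have "A y = A x + enn2real (Pe x y)"
      unfolding A_def using Pe_add[of 0 x y] that by (simp add: enn2real_plus)
    moreover have "enn2real (Pe x y) \<le> y - x"
      using Pe_le[of x y] that by (intro enn2real_leI) auto
    ultimately show "Pe x y = ennreal (A y - A x)" "0 \<le> A y - A x" "A y - A x \<le> y - x"
      using fin by auto
  qed
  have A0: "A 0 = 0" by (simp add: A_def Pe_def)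
  \<comment> \<open>\<open>C = exp b\<close> bounds \<open>exp (A y)\<close>, since
    \<open>A y \<le> y \<le> b\<close>. The other factor is a second-order error in
    \<open>d\<close>, and \<open>d \<le> y - x\<close>.\<close>
  have "w 0 * exp (A 0) = w b * exp (A b)"
  proof (rule constant_if_quadratically_close[where F="\<lambda>x. w x * exp (A x)" and C="exp b"])
    fix x y assume xy: "0 \<le> x" "x \<le> y" "y \<le> b"
    define d where "d = A y - A x"
    note d = Pe_A[OF xy(1,2), folded d_def]
    have "ennreal (w y + w y * d) \<le> ennreal (w x)"
      using W_lower[OF xy(2)] w0[of y] d by (simp add: W_w ennreal_mult)
    then have lower: "w y + w y * d \<le> w x"
      by (simp add: w0 ennreal_le_iff)
    have "ennreal (w x) \<le> ennreal (w y + w x * d)"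
      using W_upper[OF xy(2)] w0[of x] w0[of y] d by (simp add: W_w ennreal_mult)
    then have upper: "w x \<le> w y + w x * d"
      by (rule ennreal_le_iff[THEN iffD1, rotated]) (use w0[of x] w0[of y] d in simp)
    have e1: "1 - d \<le> exp (- d)"
      using exp_ge_add_one_self[of "- d"] by simp
    have e2: "exp (- d) \<le> 1 - d + d\<^sup>2"
    proof -
      \<comment> \<open>The product is \<open>1 + d ^ 3\<close>.\<close>
      have "1 \<le> (1 - d + d\<^sup>2) * (1 + d)"
        using d by (simp add: field_simps power2_eq_square)
      also have "\<dots> \<le> (1 - d + d\<^sup>2) * exp d"
      proof (rule mult_left_mono)
        have "0 \<le> (1 - d / 2)\<^sup>2 + d\<^sup>2 * (3 / 4)" by simp
        then show "0 \<le> 1 - d + d\<^sup>2" by (simp add: power2_eq_square algebra_simps)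
      qed (use exp_ge_add_one_self[of d] in simp)
      finally show ?thesis by (simp add: exp_minus divide_simps)
    qed
    have "w x * exp (- d) \<le> w x * (1 - d + d\<^sup>2)"
      using e2 w0[of x] by (intro mult_left_mono)
    moreover have "w x * d\<^sup>2 \<le> 1 * d\<^sup>2"
      using w1[OF xy(1)] by (intro mult_right_mono) auto
    ultimately have u: "w x * exp (- d) - w y \<le> d\<^sup>2"
      using upper by (simp add: algebra_simps)
    have "(w y + w y * d) * (1 - d) \<le> w x * exp (- d)"
    \<comment> \<open>Comparing factor by factor needs \<open>1 - d\<close> to be nonnegative;
      otherwise the left-hand side is at most 0.\<close>
    proof (cases "d \<le> 1")
      case True
      then show ?thesis using lower e1 d w0[of x] w0[of y] by (intro mult_mono) auto
    next
      case False
      then have "(w y + w y * d) * (1 - d) \<le> 0"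
        using d w0[of y] by (intro mult_nonneg_nonpos) auto
      also have "0 \<le> w x * exp (- d)" using w0 by simp
      finally show ?thesis .
    qed
    moreover have "w y * d\<^sup>2 \<le> 1 * d\<^sup>2"
      using w1[of y] xy by (intro mult_right_mono) auto
    ultimately have l: "- d\<^sup>2 \<le> w x * exp (- d) - w y"
      by (simp add: algebra_simps power2_eq_square)
    have "w x * exp (A x) - w y * exp (A y) = exp (A y) * (w x * exp (- d) - w y)"
      by (simp add: d_def algebra_simps flip: exp_add)
    then have "\<bar>w x * exp (A x) - w y * exp (A y)\<bar> = exp (A y) * \<bar>w x * exp (- d) - w y\<bar>"
      by (simp add: abs_mult)
    also have "\<dots> \<le> exp b * (y - x)\<^sup>2"
    proof (intro mult_mono)
      show "exp (A y) \<le> exp b" using Pe_A[of 0 y] xy A0 by simp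
      have "\<bar>w x * exp (- d) - w y\<bar> \<le> d\<^sup>2" using u l by linarith
      also have "\<dots> \<le> (y - x)\<^sup>2" using d by (intro power_mono) auto
      finally show "\<bar>w x * exp (- d) - w y\<bar> \<le> (y - x)\<^sup>2" .
    qed auto
    finally show "\<bar>w x * exp (A x) - w y * exp (A y)\<bar> \<le> exp b * (y - x)\<^sup>2" .
  qed fact
  \<comment> \<open>The bound on \<open>\<phi>\<close> provides the terminal value: from time
    \<open>b\<close> on every constraint holds, so \<open>ve b = 1\<close>.\<close>
  moreover have "w b = exp (- b)"
  proof -
    have "AE X in S. I b X = 1"
      using AE_S_pos AE_space
    proof eventually_elim
      case (elim X)
      have "\<phi> (snd (X !! i)) \<le> ennreal (b + arrival X i)" for i
      proof -
        have "X !! i \<in> space D"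
          using elim(2) by (auto simp: space_stream_space streams_iff_snth)
        then have "\<phi> (snd (X !! i)) \<le> ennreal b"
          by (intro bound) (auto simp: space_pair_measure)
        also have "\<dots> \<le> ennreal (b + arrival X i)"
          using arrival_pos[of X i] elim(1) by (intro ennreal_leI) auto
        finally show ?thesis .
      qed
      then show ?case by (simp add: I_def)
    qed
    then have "ve b = (\<integral>\<^sup>+X. 1 \<partial>S)"
      unfolding ve_def by (rule nn_integral_cong_AE)
    then show ?thesis by (simp add: w_def W_def S.emeasure_space_1)
  qed
  ultimately have w_0: "w 0 = exp (A b - b)"
    using A0 by (simp flip: exp_add)
  \<comment> \<open>The exponent \<open>b - A b\<close> is the integral of \<open>1 - pe\<close>
    over \<open>{0<..b}\<close>, which the layer-cake formula identifies with the integral of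
    \<open>\<phi>\<close>.\<close>
  have "(\<integral>\<^sup>+m. \<phi> m \<partial>Q) + Pe 0 b = ennreal b"
  proof -
    have "(\<integral>\<^sup>+m. \<phi> m \<partial>Q) = (\<integral>\<^sup>+t. emeasure Q {m\<in>space Q. ennreal t < \<phi> m} * indicator {0<..} t \<partial>lborel)"
      by (rule nn_integral_layer_cake_strict) (auto intro: sigma_finite_measure_axioms)
    also have "\<dots> = (\<integral>\<^sup>+t. (1 - pe t) * indicator {0<..b} t \<partial>lborel)"
    proof (intro nn_integral_cong)
      fix t :: real
      have "emeasure Q {m\<in>space Q. ennreal t < \<phi> m} = emeasure Q (space Q - {m\<in>space Q. \<phi> m \<le> ennreal t})"
        by (intro arg_cong[where f="emeasure Q"]) auto
      also have "\<dots> = 1 - pe t"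
        unfolding pe_def by (subst emeasure_compl) (auto simp: emeasure_space_1)
      finally have *: "emeasure Q {m\<in>space Q. ennreal t < \<phi> m} = 1 - pe t" .
      have "1 - pe t = 0" if "b < t"
      proof -
        have "{m\<in>space Q. ennreal t < \<phi> m} = {}"
          using bound that \<open>0 \<le> b\<close> by (force simp: not_less intro: order_trans ennreal_leI)
        then show ?thesis using * by (simp only: emeasure_empty)
      qed
      then show "emeasure Q {m\<in>space Q. ennreal t < \<phi> m} * indicator {0<..} t = (1 - pe t) * indicator {0<..b} t"
        unfolding * by (auto split: split_indicator)
    qed
    finally have "(\<integral>\<^sup>+m. \<phi> m \<partial>Q) + Pe 0 b
        = (\<integral>\<^sup>+t. (1 - pe t) * indicator {0<..b} t + pe t * indicator {0<..b} t \<partial>lborel)"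
      unfolding Pe_def by (simp add: nn_integral_add)
    also have "\<dots> = (\<integral>\<^sup>+t. indicator {0<..b} t \<partial>lborel)"
      using pe_le by (intro nn_integral_cong) (auto simp: diff_add_cancel_ennreal split: split_indicator)
    finally show ?thesis using \<open>0 \<le> b\<close> by simp
  qed
  moreover have "Pe 0 b = ennreal (A b)" "0 \<le> A b"
    using Pe_A[of 0 b] \<open>0 \<le> b\<close> A0 by auto
  ultimately have "(\<integral>\<^sup>+m. \<phi> m \<partial>Q) = ennreal (b - A b)"
    by (metis ennreal_add_diff_cancel_right ennreal_minus ennreal_neq_top)
  moreover have "A b \<le> b" using Pe_A[of 0 b] \<open>0 \<le> b\<close> A0 by auto
  ultimately have phi: "- enn2real (\<integral>\<^sup>+m. \<phi> m \<partial>Q) = A b - b" by simp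
  have "emeasure S {X\<in>space S. \<forall>i. \<phi> (snd (X !! i)) \<le> ennreal (arrival X i)} 
      = (\<integral>\<^sup>+X. indicator {X\<in>space S. \<forall>i. \<phi> (snd (X !! i)) \<le> ennreal (arrival X i)} X \<partial>S)"
    by simp
  also have "\<dots> = ve 0"
    unfolding ve_def by (intro nn_integral_cong) (simp add: I_def indicator_def)
  also have "\<dots> = W 0" by (simp add: W_def)
  finally show ?thesis unfolding W_w w_0 phi .
qed

end

section \<open>Reciprocals of infima; sigma-finiteness of the spectral measure\<close>

lemma inverse_antimono_ennreal: "x \<le> y \<Longrightarrow> inverse y \<le> inverse (x::ennreal)"
  by (simp add: less_eq_ennreal.rep_eq inverse_ennreal.rep_eq ereal_inverse_antimono)

text \<open>\<open>inverse\<close> exchanges 0 and \<infinity>, so it is an order-reversing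
  involution on all of \<open>ennreal\<close>; the swap rules and \<open>inverse_INF_ennreal\<close>
  rest on this.\<close>

lemma inverse_inverse_ennreal: "inverse (inverse x) = (x::ennreal)"
proof (cases x)
  case (real r)
  then show ?thesis by (cases "r = 0") (auto simp: inverse_ennreal)
qed simp

lemma inverse_le_swap_ennreal: "inverse a \<le> b \<longleftrightarrow> inverse b \<le> (a::ennreal)"
  by (metis inverse_antimono_ennreal inverse_inverse_ennreal)

lemma inverse_INF_ennreal: "inverse (INF i\<in>I. a i) = (SUP i\<in>I. inverse (a i :: ennreal))"
proof (rule antisym)
  show "inverse (INF i\<in>I. a i) \<le> (SUP i\<in>I. inverse (a i))"
    by (rule inverse_le_swap_ennreal[THEN iffD1], rule INF_greatest, rule inverse_le_swap_ennreal[THEN iffD1])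
       (rule SUP_upper)
  show "(SUP i\<in>I. inverse (a i)) \<le> inverse (INF i\<in>I. a i)"
  proof (rule SUP_least)
    fix i assume "i \<in> I"
    then have "(INF i\<in>I. a i) \<le> a i" by (rule INF_lower)
    then show "inverse (a i) \<le> inverse (INF i\<in>I. a i)"
      by (rule inverse_antimono_ennreal)
  qed
qed

lemma le_inverse_swap_ennreal: "a \<le> inverse b \<longleftrightarrow> b \<le> inverse (a::ennreal)"
  by (metis inverse_antimono_ennreal inverse_inverse_ennreal)

lemma divide_le_iff_ennreal: "0 < r \<Longrightarrow> a / ennreal r \<le> b \<longleftrightarrow> a \<le> b * ennreal r"
  by (cases a rule: ennreal_cases; cases b rule: ennreal_cases)
     (auto simp: divide_ennreal ennreal_mult[symmetric] field_simps ennreal_top_mult ennreal_top_divide top_unique)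

text \<open>The reciprocal of a minimum is at least \<open>t\<close> iff some coordinate is at most
  \<open>1 / t\<close>. The probability of such a union follows from those of the finite
  intersections, all at the same level.\<close>

lemma nn_integral_inverse_INF_eq:
  fixes Y :: "'a \<Rightarrow> nat \<Rightarrow> ennreal" and Z :: "'b \<Rightarrow> nat \<Rightarrow> ennreal"
  assumes "prob_space M" "prob_space N"
    and Y [measurable]: "\<And>n. (\<lambda>\<omega>. Y \<omega> n) \<in> borel_measurable M"
    and Z [measurable]: "\<And>n. (\<lambda>\<omega>. Z \<omega> n) \<in> borel_measurable N"
    and eq: "\<And>G s. finite G \<Longrightarrow> 0 < s \<Longrightarrow>
      emeasure M {\<omega>\<in>space M. \<forall>n\<in>G. Y \<omega> n \<le> ennreal s}
        = emeasure N {\<omega>\<in>space N. \<forall>n\<in>G. Z \<omega> n \<le> ennreal s}"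
  shows "(\<integral>\<^sup>+\<omega>. inverse (INF n. Y \<omega> n) \<partial>M) = (\<integral>\<^sup>+\<omega>. inverse (INF n. Z \<omega> n) \<partial>N)"
proof -
  interpret M: prob_space M by fact
  interpret N: prob_space N by fact
  \<comment> \<open>Finitely many indices first: a supremum that is at least \<open>t\<close> yields
    a single index only if it is attained.\<close>
  have MCT: "(\<integral>\<^sup>+\<omega>. inverse (INF n. Y \<omega> n) \<partial>L) = (SUP m. \<integral>\<^sup>+\<omega>. (SUP n\<in>{..m}. inverse (Y \<omega> n)) \<partial>L)"
    if [measurable]: "\<And>n. (\<lambda>\<omega>. Y \<omega> n) \<in> borel_measurable L"
    for Y :: "'l \<Rightarrow> nat \<Rightarrow> ennreal" and L
  proof -
    have "inverse (INF n. Y \<omega> n) = (SUP m. SUP n\<in>{..m}. inverse (Y \<omega> n))" for \<omega>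
      unfolding inverse_INF_ennreal
      by (intro antisym SUP_least) (auto intro: SUP_upper2 SUP_upper)
    then show ?thesis
      by (simp, subst nn_integral_monotone_convergence_SUP)
         (auto simp: incseq_def le_fun_def intro!: SUP_subset_mono)
  qed
  have layer: "(\<integral>\<^sup>+\<omega>. (SUP n\<in>{..m}. inverse (Y \<omega> n)) \<partial>L)
      = (\<integral>\<^sup>+t. emeasure L (space L \<inter> (\<Union>n\<in>{..m}. {\<omega>\<in>space L. Y \<omega> n \<le> ennreal (1 / t)})) * indicator {0<..} t \<partial>lborel)"
    if "prob_space L" and [measurable]: "\<And>n. (\<lambda>\<omega>. Y \<omega> n) \<in> borel_measurable L"
    for Y :: "'l \<Rightarrow> nat \<Rightarrow> ennreal" and L m
  proof -
    have fin: "ennreal t \<le> (SUP n\<in>{..m}. inverse (Y \<omega> n)) \<longleftrightarrow> (\<exists>n\<in>{..m}. Y \<omega> n \<le> ennreal (1 / t))"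
      if "0 < t" for t \<omega>
    proof -
      have "(SUP n\<in>{..m}. inverse (Y \<omega> n)) = (MAX n\<in>{..m}. inverse (Y \<omega> n))"
        by (rule Max_Sup[symmetric]) auto
      also have "ennreal t \<le> \<dots> \<longleftrightarrow> (\<exists>n\<in>{..m}. ennreal t \<le> inverse (Y \<omega> n))"
        by (subst Max_ge_iff) auto
      finally show ?thesis
        using that by (simp add: le_inverse_swap_ennreal[of "ennreal t"] inverse_ennreal inverse_eq_divide)
    qed
    show ?thesis
      by (subst nn_integral_layer_cake)
         (auto simp: fin intro!: that(1) prob_space_imp_sigma_finite nn_integral_cong arg_cong[where f="emeasure L"]
           split: split_indicator)
  qed
  have "emeasure M (space M \<inter> (\<Union>n\<in>{..m}. {\<omega>\<in>space M. Y \<omega> n \<le> ennreal (1 / t)}))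
    = emeasure N (space N \<inter> (\<Union>n\<in>{..m}. {\<omega>\<in>space N. Z \<omega> n \<le> ennreal (1 / t)}))" if "0 < t" for m t
  proof -
    let ?A = "\<lambda>n. {\<omega>\<in>space M. Y \<omega> n \<le> ennreal (1 / t)}"
    let ?B = "\<lambda>n. {\<omega>\<in>space N. Z \<omega> n \<le> ennreal (1 / t)}"
    have "emeasure M (space M \<inter> (\<Inter>n\<in>{}. ?A n) - (\<Union>n\<in>{..m}. ?A n))
      = emeasure N (space N \<inter> (\<Inter>n\<in>{}. ?B n) - (\<Union>n\<in>{..m}. ?B n))"
    proof (rule emeasure_Inter_Diff_Union_eq)
      fix G :: "nat set" assume "finite G"
      have "space M \<inter> (\<Inter>n\<in>G. ?A n) = {\<omega>\<in>space M. \<forall>n\<in>G. Y \<omega> n \<le> ennreal (1 / t)}"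
        "space N \<inter> (\<Inter>n\<in>G. ?B n) = {\<omega>\<in>space N. \<forall>n\<in>G. Z \<omega> n \<le> ennreal (1 / t)}"
        by auto
      then show "emeasure M (space M \<inter> (\<Inter>n\<in>G. ?A n)) = emeasure N (space N \<inter> (\<Inter>n\<in>G. ?B n))"
        using eq[OF \<open>finite G\<close>, of "1 / t"] that by simp
    qed (auto intro: M.finite_measure_axioms N.finite_measure_axioms)
    then have "emeasure M (space M - (\<Union>n\<in>{..m}. ?A n)) = emeasure N (space N - (\<Union>n\<in>{..m}. ?B n))"
      by simp
    then have "1 - emeasure M (space M - (\<Union>n\<in>{..m}. ?A n)) = 1 - emeasure N (space N - (\<Union>n\<in>{..m}. ?B n))"
      by simp
    moreover have "1 - emeasure M (space M - (\<Union>n\<in>{..m}. ?A n)) = emeasure M (space M - (space M - (\<Union>n\<in>{..m}. ?A n)))"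
      by (subst (2) emeasure_compl) (auto simp: M.emeasure_space_1)
    moreover have "1 - emeasure N (space N - (\<Union>n\<in>{..m}. ?B n)) = emeasure N (space N - (space N - (\<Union>n\<in>{..m}. ?B n)))"
      by (subst (2) emeasure_compl) (auto simp: N.emeasure_space_1)
    moreover have "space M - (space M - X) = space M \<inter> X" for X by auto
    moreover have "space N - (space N - X) = space N \<inter> X" for X by auto
    ultimately show ?thesis by simp
  qed
  then have "(\<integral>\<^sup>+\<omega>. (SUP n\<in>{..m}. inverse (Y \<omega> n)) \<partial>M) = (\<integral>\<^sup>+\<omega>. (SUP n\<in>{..m}. inverse (Z \<omega> n)) \<partial>N)" for m
    unfolding layer[OF assms(1) Y] layer[OF assms(2) Z]
    by (intro nn_integral_cong) (auto split: split_indicator)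
  then show ?thesis
    unfolding MCT[OF Y] MCT[OF Z] by simp
qed

text \<open>Among the countably many balls of radius \<open>inverse (Suc n)\<close> around a dense
  sequence, those inside a set of finite measure cover the space. Balls need not belong to
  \<open>sets H\<close>, so \<open>A\<close> chooses a measurable set of finite measure around
  each.\<close>

lemma sigma_finite_if_locally_finite:
  assumes T: "topspace T = space H" "polish_topology T" and fin: "locally_finite_measure T H"
  shows "sigma_finite_measure H"
proof -
  obtain U d where "Metric_space U d" and T_eq: "T = Metric_space.mtopology U d"
    using T(2) unfolding polish_topology_def completely_metrizable_space_def by auto
  interpret Metric_space U d by fact
  have U: "U = space H" using T(1) T_eq by simp
  obtain C where C: "countable C" "C \<subseteq> U" "mtopology closure_of C = U"
    using T(2) unfolding polish_topology_def separable_space_def T_eq by auto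
  define good where "good = {(c, n :: nat). c \<in> C \<and>
    (\<exists>A\<in>sets H. mball c (inverse (Suc n)) \<subseteq> A \<and> emeasure H A < \<infinity>)}"
  define A where "A = (\<lambda>(c, n). SOME A. A \<in> sets H \<and> mball c (inverse (real (Suc n))) \<subseteq> A \<and> emeasure H A < \<infinity>)"
  have A: "A (c, n) \<in> sets H \<and> mball c (inverse (Suc n)) \<subseteq> A (c, n) \<and> emeasure H (A (c, n)) < \<infinity>"
    if "(c, n) \<in> good" for c n
    using that someI_ex[of "\<lambda>A. A \<in> sets H \<and> mball c (inverse (real (Suc n))) \<subseteq> A \<and> emeasure H A < \<infinity>"]
    unfolding good_def A_def by auto
  have "good \<subseteq> C \<times> UNIV" by (auto simp: good_def)
  then have "countable good" by (rule countable_subset) (use C(1) in auto)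
  moreover have cover: "\<exists>p\<in>good. x \<in> A p" if x: "x \<in> space H" for x
  proof -
    obtain V B where V: "openin T V" "x \<in> V" "V \<subseteq> B" "B \<in> sets H" "emeasure H B < \<infinity>"
      using bspec[OF fin[unfolded locally_finite_measure_def], of x] x unfolding T(1) by auto
    then obtain r where r: "0 < r" "mball x r \<subseteq> V"
      unfolding T_eq openin_mtopology by blast
    \<comment> \<open>A ball of radius below \<open>r / 2\<close> that contains \<open>x\<close>
      lies in \<open>mball x r\<close>.\<close>
    obtain n where n: "inverse (real (Suc n)) < r / 2"
      using reals_Archimedean[of "r / 2"] r by auto
    have "x \<in> mtopology closure_of C" using C(3) x U by simp
    then have "\<forall>r>0. \<exists>c\<in>C. c \<in> mball x r"
      unfolding metric_closure_of by (simp del: in_mball)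
    then obtain c where c: "c \<in> C" "c \<in> mball x (inverse (real (Suc n)))"
      by (meson inverse_positive_iff_positive of_nat_0_less_iff zero_less_Suc)
    have "mball c (inverse (real (Suc n))) \<subseteq> mball x r"
    proof
      fix z assume z: "z \<in> mball c (inverse (real (Suc n)))"
      then show "z \<in> mball x r"
        using c(2) n triangle[of x c z] by auto
    qed
    then have "(c, n) \<in> good"
      using c(1) V(3,4,5) r(2) by (auto simp: good_def)
    moreover have "x \<in> A (c, n)"
      using A[OF calculation] c(2) by (auto simp: commute)
    ultimately show ?thesis by blast
  qed
  ultimately show ?thesis
  proof (intro sigma_finite_measure.intro exI[of _ "A ` good"] conjI)
    show "A ` good \<subseteq> sets H" "\<forall>a\<in>A ` good. emeasure H a \<noteq> \<infinity>"
      using A by (auto simp: less_top)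
    then show "\<Union> (A ` good) = space H"
      using cover by (auto dest: sets.sets_into_space)
  qed auto
qed

section \<open>Finite-dimensional distributions\<close>

definition inv_square :: "real measure" where
  "inv_square = density (restrict_space lborel {0<..}) (\<lambda>t. ennreal (1 / t\<^sup>2))"

lemma space_inv_square [simp]: "space inv_square = {0<..}"
  by (simp add: inv_square_def space_restrict_space)

lemma sets_inv_square: "sets inv_square = sets (restrict_space borel {0<..})"
  by (simp add: inv_square_def cong: sets_restrict_space_cong)

lemma measurable_inv_square_id [measurable]: "(\<lambda>t. t) \<in> borel_measurable inv_square"
  unfolding measurable_cong_sets[OF sets_inv_square refl]
  by (rule measurable_restrict_space1) simp

lemma spectral_intensity_eq: "spectral_intensity H = inv_square \<Otimes>\<^sub>M H"
  by (simp add: spectral_intensity_def inv_square_def)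

lemma emeasure_inv_square_Ioi:
  assumes "0 < a"
  shows "emeasure inv_square {a<..} = ennreal (1 / a)"
proof -
  have [measurable]: "{a<..} \<in> sets (restrict_space lborel {0<..})"
    using assms by (auto simp: sets_restrict_space_iff)
  have "emeasure inv_square {a<..} = (\<integral>\<^sup>+t. ennreal (1 / t\<^sup>2) * indicator {a<..} t \<partial>restrict_space lborel {0<..})"
    unfolding inv_square_def by (rule emeasure_density) (auto intro!: measurable_restrict_space1)
  also have "\<dots> = (\<integral>\<^sup>+t. ennreal (1 / t\<^sup>2) * indicator {a<..} t * indicator {0<..} t \<partial>lborel)"
    by (rule nn_integral_restrict_space) simp
  also have "\<dots> = (\<integral>\<^sup>+t. ennreal (1 / t\<^sup>2) * indicator {a..} t \<partial>lborel)"
    using AE_lborel_singleton[of a]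
    by (intro nn_integral_cong_AE, eventually_elim) (use assms in \<open>auto split: split_indicator\<close>)
  also have "\<dots> = ennreal (0 - (- (1 / a)))"
  proof (rule nn_integral_FTC_atLeast)
    show "((\<lambda>t::real. - (1 / t)) \<longlongrightarrow> 0) at_top"
      using real_tendsto_divide_at_top[OF tendsto_const[of "- 1 :: real"] filterlim_ident] by simp
    show "((\<lambda>t. - (1 / t)) has_real_derivative 1 / x\<^sup>2) (at x)" if "a \<le> x" for x
      using that assms by (auto intro!: derivative_eq_intros simp: power2_eq_square)
  qed auto
  finally show ?thesis by simp
qed

lemma sigma_finite_inv_square: "sigma_finite_measure inv_square"
proof (intro sigma_finite_measure.intro exI[of _ "range (\<lambda>n. {inverse (real (Suc n))<..})"] conjI)
  show "range (\<lambda>n. {inverse (real (Suc n))<..}) \<subseteq> sets inv_square"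
  proof safe
    fix n
    have "0 < inverse (real (Suc n))" by simp
    then show "{inverse (real (Suc n))<..} \<in> sets inv_square"
      unfolding sets_inv_square by (auto simp: sets_restrict_space_iff simp del: of_nat_Suc)
  qed
  show "\<Union> (range (\<lambda>n. {inverse (real (Suc n))<..})) = space inv_square"
  proof safe
    fix n and x :: real assume "inverse (real (Suc n)) < x"
    then show "x \<in> space inv_square"
      using inverse_positive_iff_positive[of "real (Suc n)"] by (auto simp del: inverse_positive_iff_positive)
  next
    fix x assume "x \<in> space inv_square"
    then show "x \<in> \<Union> (range (\<lambda>n. {inverse (real (Suc n))<..}))"
      using reals_Archimedean[of x] by auto
  qed
  show "\<forall>a\<in>range (\<lambda>n. {inverse (real (Suc n))<..}). emeasure inv_square a \<noteq> \<infinity>"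
    by (auto simp: emeasure_inv_square_Ioi)
qed auto

lemma point_count_eq_0_iff: "point_count PP A \<omega> = 0 \<longleftrightarrow> PP \<omega> \<inter> A = {}"
  by (simp add: point_count_def emeasure_count_space_eq_0)

lemma poisson_void_probability:
  assumes "prob_space M" and P: "poisson_point_process M \<mu> PP" and A: "A \<in> sets \<mu>" "emeasure \<mu> A < \<infinity>"
  shows "emeasure M {\<omega>\<in>space M. PP \<omega> \<inter> A = {}} = ennreal (exp (- measure \<mu> A))"
proof -
  interpret prob_space M by fact
  have "{\<omega>\<in>space M. PP \<omega> \<inter> A = {}} = {\<omega>\<in>space M. point_count PP A \<omega> = of_nat 0}"
    by (simp add: point_count_eq_0_iff)
  moreover have "measure M {\<omega>\<in>space M. point_count PP A \<omega> = of_nat 0} = measure \<mu> A ^ 0 / fact 0 * exp (- measure \<mu> A)"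
    using P A unfolding poisson_point_process_def by blast
  ultimately show ?thesis
    by (simp add: emeasure_eq_measure)
qed

text \<open>A value above \<open>a\<close> at \<open>y\<close> means that some point falls into a
  fixed measurable set, and the definition of the point process makes such counts
  measurable.\<close>

lemma measurable_max_stable:
  assumes P: "poisson_point_process M (spectral_intensity H) PP"
    and y [measurable]: "(\<lambda>h. h y) \<in> borel_measurable H"
  shows "(\<lambda>\<omega>. max_stable PP \<omega> y) \<in> borel_measurable M"
proof (rule borel_measurableI_greater)
  fix a :: ennreal
  define A where "A = {p\<in>space (inv_square \<Otimes>\<^sub>M H). a < ennreal (fst p * snd p y)}"
  have A: "A \<in> sets (inv_square \<Otimes>\<^sub>M H)"
    unfolding A_def by measurable
  then have [measurable]: "point_count PP A \<in> borel_measurable M"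
    using P unfolding poisson_point_process_def spectral_intensity_eq by blast
  have sub: "PP \<omega> \<subseteq> space (inv_square \<Otimes>\<^sub>M H)" if "\<omega> \<in> space M" for \<omega>
    using P that unfolding poisson_point_process_def spectral_intensity_eq by blast
  have "{\<omega>\<in>space M. a < max_stable PP \<omega> y} = {\<omega>\<in>space M. point_count PP A \<omega> \<noteq> 0}"
  proof (intro Collect_cong conj_cong refl)
    fix \<omega> assume "\<omega> \<in> space M"
    from sub[OF this] show "a < max_stable PP \<omega> y \<longleftrightarrow> point_count PP A \<omega> \<noteq> 0"
      unfolding max_stable_def less_SUP_iff point_count_eq_0_iff
      by (auto simp: A_def split_beta subset_eq)
  qed
  also have "\<dots> \<in> sets M" by measurable
  finally show "{\<omega>\<in>space M. a < max_stable PP \<omega> y} \<in> sets M" .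
qed

text \<open>The field stays below \<open>s\<close> on \<open>G\<close> iff no point lies in
  \<open>A\<close>. For fixed \<open>h\<close> with maximum \<open>m > 0\<close> over
  \<open>G\<close> the times in \<open>A\<close> are those beyond \<open>s / m\<close>, of mass
  \<open>m / s\<close>; integrating over \<open>h\<close> gives the exponent.\<close>

lemma max_stable_finite_dimensional:
  assumes "prob_space M" "sigma_finite_measure H"
    and P: "poisson_point_process M (spectral_intensity H) PP"
    and y [measurable]: "\<And>y. (\<lambda>h. h y) \<in> borel_measurable H"
    and nonneg: "\<And>h y. h \<in> space H \<Longrightarrow> 0 \<le> h y"
    and G: "finite G" and s: "0 < s"
    and fin: "(\<integral>\<^sup>+h. (SUP y\<in>G. ennreal (h y)) / ennreal s \<partial>H) < \<infinity>"
  shows "emeasure M {\<omega>\<in>space M. \<forall>y\<in>G. max_stable PP \<omega> y \<le> ennreal s}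
    = ennreal (exp (- enn2real (\<integral>\<^sup>+h. (SUP y\<in>G. ennreal (h y)) / ennreal s \<partial>H)))"
proof -
  interpret H: sigma_finite_measure H by fact
  interpret I: sigma_finite_measure inv_square by (rule sigma_finite_inv_square)
  interpret pair_sigma_finite inv_square H ..
  define A where "A = {p\<in>space (inv_square \<Otimes>\<^sub>M H). \<exists>y\<in>G. s < fst p * snd p y}"
  have A [measurable]: "A \<in> sets (inv_square \<Otimes>\<^sub>M H)"
    unfolding A_def using G by measurable
  have slice: "emeasure inv_square ((\<lambda>t. (t, h)) -` A) = (SUP y\<in>G. ennreal (h y)) / ennreal s"
    if h: "h \<in> space H" for h
  proof -
    \<comment> \<open>Inserting 0 covers an empty \<open>G\<close>, whose supremum in
      \<open>ennreal\<close> is 0.\<close>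
    define m where "m = Max (insert 0 (h ` G))"
    have m: "0 \<le> m" "\<And>y. y \<in> G \<Longrightarrow> h y \<le> m" "m = 0 \<or> (\<exists>y\<in>G. m = h y)"
      using G Max_in[of "insert 0 (h ` G)"] by (auto simp: m_def)
    have sup: "(SUP y\<in>G. ennreal (h y)) = ennreal m"
    proof (rule antisym)
      show "(SUP y\<in>G. ennreal (h y)) \<le> ennreal m"
        using m by (auto intro!: SUP_least ennreal_leI)
      show "ennreal m \<le> (SUP y\<in>G. ennreal (h y))"
        using m(3) by (auto intro: SUP_upper)
    qed
    have ex: "(\<exists>y\<in>G. s < t * h y) \<longleftrightarrow> s < t * m" if "0 < t" for t
    proof
      assume "\<exists>y\<in>G. s < t * h y"
      then obtain y where "y \<in> G" "s < t * h y" by blast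
      then show "s < t * m"
        using m(2)[of y] that mult_left_mono[of "h y" m t] by linarith
    next
      assume "s < t * m"
      with m(3) s show "\<exists>y\<in>G. s < t * h y" by auto
    qed
    have vimage_A: "(\<lambda>t. (t, h)) -` A = {t. 0 < t \<and> s < t * m}"
      using h ex by (auto simp: A_def space_pair_measure simp del: bex_simps) 
    show ?thesis
    proof (cases "m = 0")
      case True
      then have "(\<lambda>t. (t, h)) -` A = {}"
        unfolding vimage_A using ex s by auto
      then show ?thesis using True sup by simp
    next
      case False
      with m have "0 < m" by simp
      have pos: "0 < t" if "s < t * m" for t
      proof -
        have "0 < t * m" using that s by linarith
        then show ?thesis using \<open>0 < m\<close> by (simp add: zero_less_mult_iff)
      qed
      have "(\<lambda>t. (t, h)) -` A = {s / m<..}"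
        unfolding vimage_A using \<open>0 < m\<close> ex pos by (auto simp: divide_less_eq)
      then show ?thesis
        using sup \<open>0 < m\<close> s by (simp add: emeasure_inv_square_Ioi divide_ennreal)
    qed
  qed
  have \<mu>A: "emeasure (spectral_intensity H) A = (\<integral>\<^sup>+h. (SUP y\<in>G. ennreal (h y)) / ennreal s \<partial>H)"
    unfolding spectral_intensity_eq
    by (subst emeasure_pair_measure_alt2[OF A]) (rule nn_integral_cong, rule slice)
  have sub: "PP \<omega> \<subseteq> space (inv_square \<Otimes>\<^sub>M H)" if "\<omega> \<in> space M" for \<omega>
    using P that unfolding poisson_point_process_def spectral_intensity_eq by blast
  have "{\<omega>\<in>space M. \<forall>y\<in>G. max_stable PP \<omega> y \<le> ennreal s} = {\<omega>\<in>space M. PP \<omega> \<inter> A = {}}"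
  proof (intro Collect_cong conj_cong refl)
    fix \<omega> assume \<omega>: "\<omega> \<in> space M"
    have "(\<forall>y\<in>G. max_stable PP \<omega> y \<le> ennreal s) \<longleftrightarrow> (\<forall>p\<in>PP \<omega>. \<forall>y\<in>G. fst p * snd p y \<le> s)"
      using s by (auto simp: max_stable_def split_beta SUP_le_iff ennreal_le_iff)
    also have "\<dots> \<longleftrightarrow> PP \<omega> \<inter> A = {}"
      using sub[OF \<omega>] by (force simp: A_def not_less)
    finally show "(\<forall>y\<in>G. max_stable PP \<omega> y \<le> ennreal s) \<longleftrightarrow> PP \<omega> \<inter> A = {}" .
  qed
  then show ?thesis
    using poisson_void_probability[OF assms(1) P, of A] A \<mu>A fin
    by (simp add: spectral_intensity_eq measure_def)
qed

section \<open>The maximum field of the marked arrivals\<close>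

text \<open>\<open>q y\<close> will be the quotient of \<open>h y\<close> by
  \<open>g_star H h\<close>; this is the field with all points, of which \<open>Z_partial\<close>
  uses the first \<open>m\<close>.\<close>

definition normalized_max :: "('k \<Rightarrow> 'b \<Rightarrow> ennreal) \<Rightarrow> (real \<times> 'b) stream \<Rightarrow> 'k \<Rightarrow> ennreal" where
  "normalized_max q X y = (SUP i. q y (snd (X !! i)) / ennreal (arrival X i))"

text \<open>Deletion leaves a subfamily of the terms. This is the monotonicity that
  \<open>expected_arrivals_before_le\<close> asks for.\<close>

lemma normalized_max_merge_at: "normalized_max q (merge_at i X) y \<le> normalized_max q X y"
  unfolding normalized_max_def snd_merge_at arrival_merge_at
  by (rule SUP_least) (rule SUP_upper, simp)

context marked_arrivals
begin

lemma measurable_normalized_max [measurable (raw)]: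
  assumes [measurable]: "q y \<in> borel_measurable Q"
  shows "(\<lambda>X. normalized_max q X y) \<in> borel_measurable S"
  unfolding normalized_max_def by measurable

text \<open>Arrivals are almost surely positive, so the bounds at all \<open>y\<close> in
  \<open>G\<close> amount to one constraint per point on the single function \<open>?\<phi>\<close>,
  to which \<open>void_probability\<close> applies.\<close>

lemma normalized_max_finite_dimensional:
  assumes q [measurable]: "\<And>y. q y \<in> borel_measurable Q"
    and bound: "\<And>y m. m \<in> space Q \<Longrightarrow> q y m \<le> ennreal c" and "0 \<le> c"
    and G: "finite G" and s: "0 < s"
  shows "emeasure S {X\<in>space S. \<forall>y\<in>G. normalized_max q X y \<le> ennreal s}
    = ennreal (exp (- enn2real (\<integral>\<^sup>+m. (SUP y\<in>G. q y m) / ennreal s \<partial>Q)))"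
proof -
  let ?\<phi> = "\<lambda>m. (SUP y\<in>G. q y m) / ennreal s"
  have [measurable]: "?\<phi> \<in> borel_measurable Q"
    using G by (intro borel_measurable_divide_ennreal borel_measurable_SUP countable_finite) auto
  have "emeasure S {X\<in>space S. \<forall>y\<in>G. normalized_max q X y \<le> ennreal s}
    = emeasure S {X\<in>space S. \<forall>i. ?\<phi> (snd (X !! i)) \<le> ennreal (arrival X i)}"
  proof (rule emeasure_eq_AE)
    show "AE X in S. X \<in> {X\<in>space S. \<forall>y\<in>G. normalized_max q X y \<le> ennreal s}
      \<longleftrightarrow> X \<in> {X\<in>space S. \<forall>i. ?\<phi> (snd (X !! i)) \<le> ennreal (arrival X i)}"
      using AE_S_pos
    proof eventually_elim
      case (elim X)
      have pos: "0 < arrival X i" for i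
        using elim by (intro arrival_pos) auto
      have "(\<forall>y\<in>G. normalized_max q X y \<le> ennreal s)
        \<longleftrightarrow> (\<forall>i. \<forall>y\<in>G. q y (snd (X !! i)) / ennreal (arrival X i) \<le> ennreal s)"
        unfolding normalized_max_def SUP_le_iff by auto
      also have "\<dots> \<longleftrightarrow> (\<forall>i. \<forall>y\<in>G. q y (snd (X !! i)) \<le> ennreal (arrival X i) * ennreal s)"
        using pos by (simp add: divide_le_iff_ennreal mult.commute)
      also have "\<dots> \<longleftrightarrow> (\<forall>i. ?\<phi> (snd (X !! i)) \<le> ennreal (arrival X i))"
        using s by (simp add: divide_le_iff_ennreal SUP_le_iff)
      finally show ?case by simp
    qed
  qed (use G in measurable)
  also have "\<dots> = ennreal (exp (- enn2real (\<integral>\<^sup>+m. ?\<phi> m \<partial>Q)))"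
  proof (rule void_probability)
    fix m assume m: "m \<in> space Q"
    have "?\<phi> m \<le> ennreal c / ennreal s"
      by (intro divide_right_mono_ennreal SUP_least bound m)
    then show "?\<phi> m \<le> ennreal (c / s)"
      using s \<open>0 \<le> c\<close> by (simp add: divide_ennreal)
  qed (use s \<open>0 \<le> c\<close> in auto)
  finally show ?thesis .
qed

end

section \<open>The normalized spectral representation\<close>

lemma Int_stable_vimage_sets: "Int_stable {X -` A \<inter> \<Omega> | A. A \<in> sets M}"
proof (rule Int_stableI, clarify)
  fix A B assume "A \<in> sets M" "B \<in> sets M"
  then show "\<exists>C. (X -` A \<inter> \<Omega>) \<inter> (X -` B \<inter> \<Omega>) = X -` C \<inter> \<Omega> \<and> C \<in> sets M"
    by (intro exI[of _ "A \<inter> B"]) auto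
qed

text \<open>\<open>jointly_indep\<close> speaks of single variables. Grouping the generated
  sigma-algebras two by two makes the pairs \<open>X i\<close> independent, and independence within
  a group gives each pair its product law.\<close>

lemma distr_to_stream_eq_stream_space:
  assumes N: "prob_space N"
    and E: "\<And>j. 1 \<le> j \<Longrightarrow> distributed N lborel (E j) (exponential_density 1)"
    and f: "\<And>i. 1 \<le> i \<Longrightarrow> f i \<in> measurable N H"
    and f_law: "\<And>i. 1 \<le> i \<Longrightarrow> distr N H (f i) = Q"
    and indep: "jointly_indep N H E f"
  shows "distr N (stream_space (expo \<Otimes>\<^sub>M Q)) (\<lambda>\<omega>. to_stream (\<lambda>i. (E (Suc i) \<omega>, f (Suc i) \<omega>)))
    = stream_space (expo \<Otimes>\<^sub>M Q)"
proof -
  interpret N: prob_space N by fact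
  have sets_Q [measurable_cong, simp]: "sets Q = sets H"
    using f_law[of 1] by (metis le_refl sets_distr)
  have E_meas [measurable]: "E (Suc i) \<in> borel_measurable N" for i
    using distributed_measurable[OF E[of "Suc i"]] by simp
  have f_meas [measurable]: "f (Suc i) \<in> measurable N H" for i
    using f by simp
  define X where "X i \<omega> = (E (Suc i) \<omega>, f (Suc i) \<omega>)" for i \<omega>
  have X_meas [measurable]: "X i \<in> measurable N (borel \<Otimes>\<^sub>M H)" for i
    unfolding X_def by measurable
  define F where "F = case_sum (\<lambda>j. {E j -` B \<inter> space N | B. B \<in> sets borel})
                 (\<lambda>i. {f i -` A \<inter> space N | A. A \<in> sets H})"
  have F: "N.indep_sets F ({1..} <+> {1..})"
    using indep unfolding jointly_indep_def F_def .
  have "N.indep_sets (\<lambda>j. sigma_sets (space N) (\<Union>i\<in>{Inl (Suc j), Inr (Suc j)}. F i)) UNIV"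
  proof (rule N.indep_sets_collect_sigma)
    show "N.indep_sets F (\<Union>j\<in>UNIV. {Inl (Suc j), Inr (Suc j)})"
      by (rule N.indep_sets_mono_index[OF _ F]) auto
    show "Int_stable (F i)" for i
      by (cases i) (auto simp: F_def intro: Int_stable_vimage_sets)
    show "disjoint_family_on (\<lambda>j. {Inl (Suc j), Inr (Suc j)}) UNIV"
      by (auto simp: disjoint_family_on_def)
  qed
  moreover have "{X j -` A \<inter> space N | A. A \<in> sets (borel \<Otimes>\<^sub>M H)}
      \<subseteq> sigma_sets (space N) (\<Union>i\<in>{Inl (Suc j), Inr (Suc j)}. F i)" for j
  proof -
    let ?U = "\<Union>i\<in>{Inl (Suc j), Inr (Suc j)}. F i"
    let ?S = "sigma (space N) ?U"
    have U: "?U \<subseteq> Pow (space N)" by (auto simp: F_def)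
    have "E (Suc j) \<in> measurable ?S borel"
    proof (rule measurableI)
      fix A :: "real set" assume "A \<in> sets borel"
      then have "E (Suc j) -` A \<inter> space N \<in> ?U" by (auto simp: F_def)
      then show "E (Suc j) -` A \<inter> space ?S \<in> sets ?S"
        using U by (simp add: sets_measure_of space_measure_of)
    qed simp
    moreover have "f (Suc j) \<in> measurable ?S H"
    proof (rule measurableI)
      fix A assume "A \<in> sets H"
      then have "f (Suc j) -` A \<inter> space N \<in> ?U" by (auto simp: F_def)
      then show "f (Suc j) -` A \<inter> space ?S \<in> sets ?S"
        using U by (simp add: sets_measure_of space_measure_of)
    next
      fix x assume "x \<in> space ?S"
      then show "f (Suc j) x \<in> space H"
        using measurable_space[OF f_meas] U by (simp add: space_measure_of)
    qed
    ultimately have "X j \<in> measurable ?S (borel \<Otimes>\<^sub>M H)"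
      unfolding X_def by measurable
    then show ?thesis
      using U by (auto dest!: measurable_sets simp: sets_measure_of space_measure_of)
  qed
  ultimately have "N.indep_vars (\<lambda>_. borel \<Otimes>\<^sub>M H) X UNIV"
    unfolding N.indep_vars_def2 using X_meas by (auto intro: N.indep_sets_mono_sets)
  then have PiM: "distr N (\<Pi>\<^sub>M i\<in>UNIV. borel \<Otimes>\<^sub>M H) (\<lambda>\<omega>. \<lambda>i\<in>UNIV. X i \<omega>)
      = (\<Pi>\<^sub>M i\<in>UNIV. distr N (borel \<Otimes>\<^sub>M H) (X i))"
    by (subst (asm) N.indep_vars_iff_distr_eq_PiM') auto
  have law: "distr N (borel \<Otimes>\<^sub>M H) (X i) = expo \<Otimes>\<^sub>M Q" for i
  proof (rule pair_measure_eqI[symmetric])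
    interpret e: prob_space expo by (rule prob_space_expo)
    show "sigma_finite_measure expo" ..
    interpret Q: prob_space Q
      using f_law[of 1] N.prob_space_distr[of "f 1" H] f[of 1] by simp
    show "sigma_finite_measure Q" ..
    show "sets (expo \<Otimes>\<^sub>M Q) = sets (distr N (borel \<Otimes>\<^sub>M H) (X i))"
      by (simp cong: sets_pair_measure_cong)
    fix A B assume A: "A \<in> sets expo" and B: "B \<in> sets Q"
    then have [measurable]: "A \<in> sets borel" "B \<in> sets H" by auto
    let ?J = "{Inl (Suc i), Inr (Suc i)} :: (nat + nat) set"
    let ?C = "case_sum (\<lambda>_. E (Suc i) -` A \<inter> space N) (\<lambda>_. f (Suc i) -` B \<inter> space N) :: nat + nat \<Rightarrow> _"
    have "N.prob (\<Inter>j\<in>?J. ?C j) = (\<Prod>j\<in>?J. N.prob (?C j))"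
      using A B by (intro N.indep_setsD[OF F]) (auto simp: F_def)
    moreover have "(\<Inter>j\<in>?J. ?C j) = X i -` (A \<times> B) \<inter> space N"
      by (auto simp: X_def)
    ultimately have "N.prob (X i -` (A \<times> B) \<inter> space N)
      = N.prob (E (Suc i) -` A \<inter> space N) * N.prob (f (Suc i) -` B \<inter> space N)"
      by simp
    moreover have "emeasure expo A = N.prob (E (Suc i) -` A \<inter> space N)"
    proof -
      have "expo = distr N lborel (E (Suc i))"
        using distributed_distr_eq_density[OF E[of "Suc i"]] by (simp add: expo_def)
      then have "emeasure expo A = emeasure (distr N lborel (E (Suc i))) A"
        by (rule arg_cong)
      then show ?thesis
        by (simp add: emeasure_distr N.emeasure_eq_measure)
    qed
    moreover have "emeasure Q B = N.prob (f (Suc i) -` B \<inter> space N)"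
      using f_law[of "Suc i"] f_meas
      by (subst f_law[of "Suc i", symmetric]) (auto simp: emeasure_distr N.emeasure_eq_measure)
    ultimately show "emeasure expo A * emeasure Q B = emeasure (distr N (borel \<Otimes>\<^sub>M H) (X i)) (A \<times> B)"
      by (simp add: emeasure_distr N.emeasure_eq_measure ennreal_mult)
  qed
  have sets_PiM: "sets (\<Pi>\<^sub>M i\<in>(UNIV::nat set). borel \<Otimes>\<^sub>M H) = sets (\<Pi>\<^sub>M i\<in>(UNIV::nat set). expo \<Otimes>\<^sub>M Q)"
    by (intro sets_PiM_cong sets_pair_measure_cong) auto
  have "stream_space (expo \<Otimes>\<^sub>M Q) = distr (\<Pi>\<^sub>M i\<in>UNIV. expo \<Otimes>\<^sub>M Q) (stream_space (expo \<Otimes>\<^sub>M Q)) to_stream"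
    by (rule stream_space_eq_distr)
  also have "\<dots> = distr (distr N (\<Pi>\<^sub>M i\<in>UNIV. borel \<Otimes>\<^sub>M H) (\<lambda>\<omega>. \<lambda>i\<in>UNIV. X i \<omega>)) (stream_space (expo \<Otimes>\<^sub>M Q)) to_stream"
    by (simp add: PiM law)
  also have "\<dots> = distr N (stream_space (expo \<Otimes>\<^sub>M Q)) (to_stream \<circ> (\<lambda>\<omega>. \<lambda>i\<in>UNIV. X i \<omega>))"
  proof (rule distr_distr)
    show "to_stream \<in> measurable (\<Pi>\<^sub>M i\<in>UNIV. borel \<Otimes>\<^sub>M H) (stream_space (expo \<Otimes>\<^sub>M Q))"
      unfolding measurable_cong_sets[OF sets_PiM refl] by (rule measurable_to_stream)
    show "(\<lambda>\<omega>. \<lambda>i\<in>UNIV. X i \<omega>) \<in> measurable N (\<Pi>\<^sub>M i\<in>UNIV. borel \<Otimes>\<^sub>M H)"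
      by (intro measurable_restrict X_meas)
  qed
  also have "to_stream \<circ> (\<lambda>\<omega>. \<lambda>i\<in>UNIV. X i \<omega>) = (\<lambda>\<omega>. to_stream (\<lambda>i. (E (Suc i) \<omega>, f (Suc i) \<omega>)))"
    by (simp add: fun_eq_iff X_def restrict_def)
  finally show ?thesis by (rule sym)
qed

text \<open>Degenerate divisors are harmless: \<open>d = 0\<close> forces \<open>a = 0\<close> with
  \<open>0 / 0 = 0\<close>, and division by \<infinity> gives 0.\<close>

lemma divide_le_ennrealI:
  assumes "a \<le> b * d" shows "a / d \<le> (b :: ennreal)"
proof (cases d)
  case (real r)
  then show ?thesis
    using assms by (cases "r = 0") (auto simp: divide_le_iff_ennreal)
qed (simp add: divide_ennreal_def)

section \<open>The class of spectral functions and the stopping rule\<close>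

locale spectral_functions =
  fixes HH :: "('k \<Rightarrow> real) set" and H :: "('k \<Rightarrow> real) measure" and K0 :: "'k set"
  assumes space_H: "space H = HH"
    and sets_H: "sets H = sigma_sets HH (cylinder_sets HH)"
    and nonneg: "h \<in> HH \<Longrightarrow> 0 \<le> h y"
    and countable_K0: "countable K0"
    and order: "h1 \<in> HH \<Longrightarrow> h2 \<in> HH \<Longrightarrow> (\<forall>y. h1 y < h2 y) \<longleftrightarrow> (\<exists>\<epsilon>>0. \<forall>y\<in>K0. h1 y < h2 y - \<epsilon>)"
    and max_closed: "\<lbrakk>h1 \<in> HH; h2 \<in> HH; 0 \<le> t1; 0 \<le> t2\<rbrakk> \<Longrightarrow> (\<lambda>y. max (t1 * h1 y) (t2 * h2 y)) \<in> HH"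
    and one: "(\<lambda>_. 1) \<in> HH"
    and normalized: "(\<integral>\<^sup>+h. ennreal (h y) \<partial>H) = 1"
    and sup_measurable: "(\<lambda>h. SUP y. ennreal (h y)) \<in> borel_measurable H"
    and sup_finite: "sup_const H < \<infinity>"
begin

lemma measurable_eval [measurable]: "(\<lambda>h. h y) \<in> borel_measurable H"
proof (rule measurableI)
  fix B :: "real set" assume "B \<in> sets borel"
  then have "{h\<in>HH. h y \<in> B \<inter> {0..}} \<in> cylinder_sets HH"
    unfolding cylinder_sets_def by (intro CollectI exI[of _ y] exI[of _ "B \<inter> {0..}"]) auto
  moreover have "(\<lambda>h. h y) -` B \<inter> space H = {h\<in>HH. h y \<in> B \<inter> {0..}}"
    using nonneg by (auto simp: space_H)
  ultimately show "(\<lambda>h. h y) -` B \<inter> space H \<in> sets H"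
    by (simp add: sets_H)
qed simp

lemma measurable_g_star [measurable]: "g_star H \<in> borel_measurable H"
  unfolding g_star_def[abs_def] using sup_measurable by measurable

text \<open>For empty \<open>K0\<close> the condition \<open>order\<close> would hold vacuously on
  the right and give \<open>1 < 1\<close>.\<close>

lemma K0_nonempty: "K0 \<noteq> {}"
  using order[OF one one] by (auto intro: exI[of _ 1])

lemma scale_closed: "h \<in> HH \<Longrightarrow> 0 \<le> t \<Longrightarrow> (\<lambda>y. t * h y) \<in> HH"
  using max_closed[of h h t t] by simp

lemma Max_closed:
  assumes "\<And>i. h i \<in> HH" "\<And>i. 0 \<le> t i" "1 \<le> m"
  shows "(\<lambda>y. MAX i\<in>{1..m::nat}. t i * h i y) \<in> HH"
  using \<open>1 \<le> m\<close>
proof (induction m rule: dec_induct)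
  case base
  then show ?case using scale_closed[OF assms(1,2)] by simp
next
  case (step m)
  have "(\<lambda>y. MAX i\<in>{1..Suc m}. t i * h i y)
    = (\<lambda>y. max (t (Suc m) * h (Suc m) y) (1 * (MAX i\<in>{1..m}. t i * h i y)))"
    using step(1) by (auto simp: atLeastAtMostSuc_conv)
  also have "\<dots> \<in> HH"
    by (rule max_closed) (use assms step.IH in auto)
  finally show ?case .
qed

text \<open>The constant \<open>r\<close> belongs to \<open>HH\<close>, so \<open>order\<close> can
  compare it with \<open>h\<close>; the room between \<open>r\<close> and \<open>r'\<close> supplies
  the uniform gap.\<close>

lemma less_if_uniformly_less_on_K0:
  assumes "h \<in> HH" "0 \<le> r" "r < r'" "\<And>y. y \<in> K0 \<Longrightarrow> r' \<le> h y"
  shows "r < h y"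
proof -
  have "(\<lambda>_. r) \<in> HH" using scale_closed[OF one \<open>0 \<le> r\<close>] by simp
  moreover have "\<exists>\<epsilon>>0. \<forall>y\<in>K0. r < h y - \<epsilon>"
    using assms(3,4) by (intro exI[of _ "(r' - r) / 2"]) (force simp: field_simps)
  ultimately show ?thesis using order[of "\<lambda>_. r" h] assms(1) by blast
qed

text \<open>If \<open>r\<close> bounds the quotient on \<open>K0\<close>, then \<open>h\<close> lies
  below \<open>(r + e) * z\<close> there with a gap that is uniform because
  \<open>z \<ge> \<delta>\<close>. By \<open>order\<close> the inequality extends to all points, and
  \<open>e\<close> is arbitrary.\<close>

lemma SUP_quotient_eq_SUP_K0:
  assumes h: "h \<in> HH" and z: "z \<in> HH" and "0 < \<delta>" and \<delta>: "\<And>y. \<delta> \<le> z y"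
  shows "(SUP y. ennreal (h y) / ennreal (z y)) = (SUP y\<in>K0. ennreal (h y) / ennreal (z y))"
proof (rule antisym)
  have z0: "0 < z y" for y using \<delta>[of y] \<open>0 < \<delta>\<close> by linarith
  have q: "ennreal (h y) / ennreal (z y) = ennreal (h y / z y)" for y
    using z0 nonneg[OF h] by (simp add: divide_ennreal)
  show "(SUP y. ennreal (h y) / ennreal (z y)) \<le> (SUP y\<in>K0. ennreal (h y) / ennreal (z y))"
  proof (cases "SUP y\<in>K0. ennreal (h y) / ennreal (z y)")
    case (real r)
    have K0: "h y \<le> r * z y" if "y \<in> K0" for y
    proof -
      have "ennreal (h y / z y) \<le> ennreal r"
        unfolding real(2)[symmetric] q[symmetric] using that by (rule SUP_upper)
      then show ?thesis using real z0[of y] by (simp add: ennreal_le_iff divide_le_eq)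
    qed
    have "h y \<le> (r + e) * z y" if "0 < e" for y e
    proof -
      have "(\<lambda>y. (r + e) * z y) \<in> HH" using scale_closed[OF z] real \<open>0 < e\<close> by simp
      moreover have "\<exists>\<epsilon>>0. \<forall>y\<in>K0. h y < (r + e) * z y - \<epsilon>"
      proof (intro exI[of _ "e * \<delta> / 2"] conjI ballI)
        fix y assume "y \<in> K0"
        have "e * \<delta> \<le> e * z y" using \<delta> \<open>0 < e\<close> by simp
        moreover have "0 < e * \<delta>" using \<open>0 < e\<close> \<open>0 < \<delta>\<close> by simp
        ultimately have "e * \<delta> / 2 < e * z y" by linarith
        with K0[OF \<open>y \<in> K0\<close>] show "h y < (r + e) * z y - e * \<delta> / 2"
          by (simp add: algebra_simps)
      qed (use \<open>0 < e\<close> \<open>0 < \<delta>\<close> in simp)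
      ultimately have "\<forall>y. h y < (r + e) * z y" using order[OF h] by blast
      then show ?thesis by (simp add: less_imp_le)
    qed
    then have "h y / z y \<le> r + e" if "0 < e" for y e
      using that z0[of y] by (simp add: divide_le_eq)
    then have "h y / z y \<le> r" for y by (rule field_le_epsilon)
    then have "(SUP y. ennreal (h y) / ennreal (z y)) \<le> ennreal r"
      unfolding q by (intro SUP_least ennreal_leI)
    then show ?thesis by (simp only: real(2))
  next
    case top
    then show ?thesis by (simp only: top_greatest)
  qed
qed (auto intro: SUP_subset_mono)

lemma sup_const_ge_1: "1 \<le> sup_const H"
proof -
  have "(\<integral>\<^sup>+h. ennreal (h y) \<partial>H) \<le> sup_const H" for y
    unfolding sup_const_def by (intro nn_integral_mono SUP_upper) simp
  then show ?thesis by (simp add: normalized)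
qed

lemma sup_const_real: "sup_const H = ennreal (enn2real (sup_const H))" "0 < enn2real (sup_const H)"
  using sup_const_ge_1 sup_finite
  by (auto simp: enn2real_positive_iff intro: less_le_trans[OF zero_less_one])

lemma le_sup_const_times_g_star: "ennreal (h y) \<le> sup_const H * g_star H h"
proof -
  have "sup_const H * inverse (sup_const H) = 1"
    by (subst (1 2) sup_const_real(1))
       (use sup_const_real(2) in \<open>simp add: inverse_ennreal ennreal_mult[symmetric]\<close>)
  then have "sup_const H * g_star H h = (SUP y. ennreal (h y))"
    unfolding g_star_def by (simp add: mult.assoc[symmetric])
  then show ?thesis by (metis SUP_upper UNIV_I)
qed

lemma quotient_g_star_le: "ennreal (h y) / g_star H h \<le> sup_const H"
  by (rule divide_le_ennrealI[OF le_sup_const_times_g_star])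

lemma AE_g_star_finite: "AE h in H. g_star H h < \<infinity>"
proof -
  have "AE h in H. (SUP y. ennreal (h y)) \<noteq> \<infinity>"
    using sup_measurable sup_finite unfolding sup_const_def by (intro nn_integral_noteq_infinite) auto
  moreover have "inverse (sup_const H) < \<infinity>"
    using sup_const_ge_1 by (auto simp: less_top[symmetric])
  ultimately show ?thesis
    unfolding g_star_def
    by (elim eventually_mono) (metis ennreal_mult_less_top infinity_ennreal_def less_top)
qed

text \<open>The density cancels the denominators; this identifies the exponents in the void
  probabilities of the two fields.\<close>

lemma nn_integral_SUP_quotient_g_star:
  assumes G: "finite G"
  shows "(\<integral>\<^sup>+h. (SUP y\<in>G. ennreal (h y) / g_star H h) / ennreal s \<partial>density H (g_star H))
    = (\<integral>\<^sup>+h. (SUP y\<in>G. ennreal (h y)) / ennreal s \<partial>H)"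
proof -
  have [measurable]: "(\<lambda>h. SUP y\<in>G. ennreal (h y) / g_star H h) \<in> borel_measurable H"
    using G by (intro borel_measurable_SUP countable_finite) measurable
  have "(\<integral>\<^sup>+h. (SUP y\<in>G. ennreal (h y) / g_star H h) / ennreal s \<partial>density H (g_star H))
    = (\<integral>\<^sup>+h. g_star H h * ((SUP y\<in>G. ennreal (h y) / g_star H h) / ennreal s) \<partial>H)"
    by (rule nn_integral_density) measurable
  also have "\<dots> = (\<integral>\<^sup>+h. (SUP y\<in>G. ennreal (h y)) / ennreal s \<partial>H)"
  proof (rule nn_integral_cong_AE, use AE_g_star_finite in eventually_elim)
    fix h assume fin: "g_star H h < \<infinity>"
    have "g_star H h * (SUP y\<in>G. ennreal (h y) / g_star H h) = (SUP y\<in>G. g_star H h * (ennreal (h y) / g_star H h))"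
      by (rule SUP_mult_left_ennreal)
    also have "\<dots> = (SUP y\<in>G. ennreal (h y))"
    proof (rule SUP_cong[OF refl])
      fix y
      show "g_star H h * (ennreal (h y) / g_star H h) = ennreal (h y)"
      proof (cases "g_star H h = 0")
        \<comment> \<open>Where \<open>g_star\<close> vanishes, so does \<open>h\<close> at every
          point, and \<open>0 * (0 / 0) = 0\<close>.\<close>
        case True
        then show ?thesis using le_sup_const_times_g_star[of h y] by simp
      next
        case False
        then show ?thesis using fin by (simp add: ennreal_times_divide mult.commute[of "g_star H h"] ennreal_mult_divide_eq less_top)
      qed
    qed
    finally show "g_star H h * ((SUP y\<in>G. ennreal (h y) / g_star H h) / ennreal s) = (SUP y\<in>G. ennreal (h y)) / ennreal s"
      by (simp add: divide_ennreal_def mult.assoc[symmetric])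
  qed
  finally show ?thesis .
qed

text \<open>Since \<^const>\<open>esssup\<close> is \<open>\<infinity>\<close> for functions that are not measurable, the supremum over \<open>K\<close> has
  to be reduced to the countable set \<open>K0\<close> first.\<close>

lemma esssup_le:
  assumes z: "z \<in> HH" and "0 < r" and r: "\<And>y. r \<le> z y" and "sup_const H \<le> ennreal r * \<Gamma>"
  shows "esssup (density H (g_star H)) (\<lambda>h. SUP y. ennreal (h y) / (g_star H h * ennreal (z y))) \<le> \<Gamma>"
proof -
  let ?F = "\<lambda>h. SUP y. ennreal (h y) / (g_star H h * ennreal (z y))"
  have z0: "0 < z y" for y using r[of y] \<open>0 < r\<close> by linarith
  have "?F h = (SUP y\<in>K0. ennreal (h y) / ennreal (z y)) / g_star H h" if h: "h \<in> HH" for h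
  proof -
    have "ennreal (h y) / (g_star H h * ennreal (z y)) = ennreal (h y) / ennreal (z y) * inverse (g_star H h)" for y
      using z0[of y] unfolding divide_ennreal_def by (subst ennreal_inverse_mult') (auto simp: mult_ac)
    then have "?F h = (SUP y. ennreal (h y) / ennreal (z y)) * inverse (g_star H h)"
      by (simp only: SUP_mult_right_ennreal)
    also have "\<dots> = (SUP y\<in>K0. ennreal (h y) / ennreal (z y)) / g_star H h"
      by (subst SUP_quotient_eq_SUP_K0[OF h z \<open>0 < r\<close> r]) (simp only: divide_ennreal_def)
    finally show ?thesis .
  qed
  then have "?F \<in> borel_measurable H \<longleftrightarrow> (\<lambda>h. (SUP y\<in>K0. ennreal (h y) / ennreal (z y)) / g_star H h) \<in> borel_measurable H"
    by (intro measurable_cong) (simp add: space_H)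
  also have "\<dots>"
    using countable_K0 by (intro borel_measurable_divide_ennreal borel_measurable_SUP) measurable
  finally have F: "?F \<in> borel_measurable (density H (g_star H))" by simp
  have le: "?F h \<le> \<Gamma>" for h
  proof (rule SUP_least, rule divide_le_ennrealI)
    fix y
    have "ennreal (h y) \<le> sup_const H * g_star H h" by (rule le_sup_const_times_g_star)
    also have "\<dots> \<le> (ennreal (z y) * \<Gamma>) * g_star H h"
      by (intro mult_right_mono order_trans[OF assms(4)] ennreal_leI r) auto
    finally show "ennreal (h y) \<le> \<Gamma> * (g_star H h * ennreal (z y))" by (simp add: mult_ac)
  qed
  show ?thesis
    unfolding esssup_eq_AE[OF F] by (rule Inf_lower) (simp add: le)
qed

text \<open>If the arrival \<open>\<Gamma>\<close> following the first \<open>m\<close> exceeds \<open>c / I\<close>, then no later spectral function can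
  contribute at a level above \<open>c / \<Gamma> < I\<close>, so the partial maximum already exceeds \<open>c / \<Gamma>\<close> on \<open>K0\<close>,
  hence everywhere, and the rule stops at \<open>m\<close>.\<close>

lemma stopping_number_le:
  fixes E :: "nat \<Rightarrow> 'v \<Rightarrow> real" and f :: "nat \<Rightarrow> 'v \<Rightarrow> 'k \<Rightarrow> real" and \<omega> :: 'v
  defines "X \<equiv> to_stream (\<lambda>i. (E (Suc i) \<omega>, f (Suc i) \<omega>))"
  assumes E: "\<And>i. 0 < E (Suc i) \<omega>" and f: "\<And>i. f (Suc i) \<omega> \<in> HH"
    and g: "\<And>i. 0 < g_star H (f (Suc i) \<omega>)" "\<And>i. g_star H (f (Suc i) \<omega>) < \<infinity>"
  shows "stopping_number H (g_star H) E f \<omega>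
    \<le> (\<Sum>i. if ennreal (arrival X i) \<le> sup_const H *
          inverse (INF y\<in>K0. normalized_max (\<lambda>y h. ennreal (h y) / g_star H h) X y) then 1 else 0)"
proof -
  define c where "c = enn2real (sup_const H)"
  have c: "sup_const H = ennreal c" "0 < c" using sup_const_real unfolding c_def by auto
  define q where "q = (\<lambda>y h. ennreal (h y) / g_star H h)"
  define I where "I = (INF y\<in>K0. normalized_max q X y)"
  define P where "P i \<longleftrightarrow> ennreal (arrival X i) \<le> sup_const H * inverse I" for i
  have X: "X !! i = (E (Suc i) \<omega>, f (Suc i) \<omega>)" for i
    by (simp add: X_def to_stream_def)
  have arrival_pos: "0 < arrival X i" for i
    by (rule arrival_pos) (simp add: X E)
  have arrival_mono: "arrival X i \<le> arrival X j" if "i \<le> j" for i j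
    unfolding arrival_def X using that by (intro sum_mono2) (auto intro: less_imp_le E)
  have arrival_eq: "(\<Sum>j=1..Suc i. E j \<omega>) = arrival X i" for i
    unfolding arrival_def X fst_conv by (induction i) simp_all
  define \<gamma> where "\<gamma> i = enn2real (g_star H (f i \<omega>))" for i
  have \<gamma>: "g_star H (f (Suc i) \<omega>) = ennreal (\<gamma> (Suc i))" "0 < \<gamma> (Suc i)" for i
    using g[of i] by (auto simp: \<gamma>_def enn2real_positive_iff)
  \<comment> \<open>\<open>E\<close> and \<open>f\<close> are indexed from 1, streams from 0; the values of \<open>t\<close> and \<open>h\<close> at 0 are dummies.\<close>
  define t where "t i = (case i of 0 \<Rightarrow> 0 | Suc i \<Rightarrow> 1 / (arrival X i * \<gamma> (Suc i)))" for i
  have t0: "0 \<le> t i" for i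
    using arrival_pos \<gamma>(2) by (auto simp: t_def less_imp_le split: nat.split)
  have term_eq: "q y (snd (X !! i)) / ennreal (arrival X i) = ennreal (t (Suc i) * f (Suc i) \<omega> y)" for i y
    using arrival_pos[of i] \<gamma>[of i] nonneg[OF f[of i]]
    by (simp add: q_def X t_def divide_ennreal field_simps)
  define h where "h i = (case i of 0 \<Rightarrow> (\<lambda>_. 1) | Suc i \<Rightarrow> f (Suc i) \<omega>)" for i
  have h: "h i \<in> HH" for i using f one by (simp add: h_def split: nat.split)
  have term_le: "q y (snd (X !! i)) / ennreal (arrival X i) \<le> ennreal (c / arrival X i)" for i y
    using quotient_g_star_le[of "f (Suc i) \<omega>" y] arrival_pos[of i] c
    by (simp add: q_def X divide_ennreal[symmetric] divide_right_mono_ennreal less_imp_le)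
  have "stopping_number H (g_star H) E f \<omega> \<le> (\<Sum>i. if P i then 1 else 0)"
  proof (cases "\<forall>i. P i")
    case True
    have "(\<Sum>i. 1 :: ennreal) = \<infinity>"
    proof (rule ccontr)
      assume "(\<Sum>i. 1 :: ennreal) \<noteq> \<infinity>"
      then obtain n where "(\<Sum>i. 1 :: ennreal) < of_nat n"
        by (metis ennreal_Ex_less_of_nat infinity_ennreal_def less_top)
      moreover have "(\<Sum>i<n. 1 :: ennreal) \<le> (\<Sum>i. 1)"
        by (rule sum_le_suminf) auto
      ultimately show False by simp
    qed
    then show ?thesis using True by simp
  next
    case False
    \<comment> \<open>Arrivals increase, so \<open>P\<close> holds exactly below \<open>m\<close>
      and the sum is \<open>m\<close>.\<close>
    define m where "m = (LEAST i. \<not> P i)"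
    have not_Pm: "\<not> P m" unfolding m_def by (rule LeastI_ex) (use False in blast)
    have P_iff: "P i \<longleftrightarrow> i < m" for i
    proof
      show "P i" if "i < m" using that not_less_Least[of i "\<lambda>i. \<not> P i"] by (auto simp: m_def)
      show "i < m" if "P i"
      proof (rule ccontr)
        assume "\<not> i < m"
        then have "ennreal (arrival X m) \<le> ennreal (arrival X i)"
          by (intro ennreal_leI arrival_mono) auto
        with \<open>P i\<close> not_Pm show False by (auto simp: P_def)
      qed
    qed
    have "(\<Sum>i. if P i then 1 else 0 :: ennreal) = (\<Sum>i\<in>{..<m}. if P i then 1 else 0)"
      by (rule suminf_finite) (auto simp: P_iff)
    also have "\<dots> = of_nat m" by (simp add: P_iff)
    finally have sum_eq: "(\<Sum>i. if P i then 1 else 0 :: ennreal) = of_nat m" .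
    \<comment> \<open>The rule starts at \<open>m = 1\<close>, so at least one arrival must be
      counted: every term of the maximum, hence \<open>I\<close>, is at most
      \<open>c / arrival X 0\<close>.\<close>
    have "P 0"
    proof -
      obtain y where "y \<in> K0" using K0_nonempty by auto
      then have "I \<le> normalized_max q X y" unfolding I_def by (rule INF_lower)
      also have "\<dots> \<le> ennreal (c / arrival X 0)"
        unfolding normalized_max_def
      proof (rule SUP_least)
        fix i
        have "q y (snd (X !! i)) / ennreal (arrival X i) \<le> ennreal (c / arrival X i)" by (rule term_le)
        also have "\<dots> \<le> ennreal (c / arrival X 0)"
          using arrival_mono[of 0 i] arrival_pos[of 0] c by (intro ennreal_leI divide_left_mono) auto
        finally show "q y (snd (X !! i)) / ennreal (arrival X i) \<le> ennreal (c / arrival X 0)" .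
      qed
      finally have "inverse (ennreal (c / arrival X 0)) \<le> inverse I"
        by (rule inverse_antimono_ennreal)
      then have "ennreal c * inverse (ennreal (c / arrival X 0)) \<le> ennreal c * inverse I"
        by (rule mult_left_mono) simp
      moreover have "ennreal c * inverse (ennreal (c / arrival X 0)) = ennreal (arrival X 0)"
        using c arrival_pos[of 0] by (simp add: inverse_ennreal ennreal_mult[symmetric])
      ultimately show ?thesis by (simp add: P_def c)
    qed
    then have "1 \<le> m" using P_iff[of 0] by simp
    define r where "r = c / arrival X m"
    have "0 < r" using c arrival_pos[of m] by (simp add: r_def)
    have "ennreal r < I"
    proof (rule ccontr)
      assume "\<not> ennreal r < I"
      then have "inverse (ennreal r) \<le> inverse I"
        by (intro inverse_antimono_ennreal) simp
      then have "ennreal c * inverse (ennreal r) \<le> ennreal c * inverse I"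
        by (rule mult_left_mono) simp
      moreover have "ennreal c * inverse (ennreal r) = ennreal (arrival X m)"
        using c arrival_pos[of m] \<open>0 < r\<close> by (simp add: inverse_ennreal ennreal_mult[symmetric] r_def)
      ultimately show False using not_Pm by (simp add: P_def c)
    qed
    \<comment> \<open>A value strictly between leaves the gap on \<open>K0\<close> that
      \<open>less_if_uniformly_less_on_K0\<close> requires.\<close>
    then obtain x where x: "ennreal r < x" "x < I" using dense by blast
    then obtain r' where r': "x = ennreal r'" "0 \<le> r'"
      by (cases x) auto
    with x \<open>0 < r\<close> have "r < r'" by (simp add: ennreal_less_iff)
    define z where "z y = (MAX i\<in>{1..m}. t i * h i y)" for y
    have z: "z \<in> HH"
      unfolding z_def[abs_def] using h t0 \<open>1 \<le> m\<close> by (intro Max_closed) auto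
    have z_K0: "r' \<le> z y" if "y \<in> K0" for y
    proof -
      have "x < normalized_max q X y"
        using x(2) INF_lower[OF that, of "normalized_max q X"] unfolding I_def by (rule less_le_trans)
      then obtain i where i: "x < q y (snd (X !! i)) / ennreal (arrival X i)"
        unfolding normalized_max_def less_SUP_iff by auto
      have "i < m"
      proof (rule ccontr)
        assume "\<not> i < m"
        then have "c / arrival X i \<le> r"
          unfolding r_def using c arrival_mono[of m i] arrival_pos[of m] by (intro divide_left_mono) auto
        then have "ennreal (c / arrival X i) \<le> ennreal r" by (rule ennreal_leI)
        with i x(1) term_le[of y i] show False by (meson leD less_trans order_trans)
      qed
      have "r' < t (Suc i) * f (Suc i) \<omega> y"
        using i r' unfolding term_eq by (simp add: ennreal_less_iff)
      also have "\<dots> \<le> z y"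
        unfolding z_def using \<open>i < m\<close> by (intro Max_ge) (auto simp: h_def intro!: image_eqI[of _ _ "Suc i"])
      finally show ?thesis by simp
    qed
    have z_gt: "r < z y" for y
      using z \<open>0 < r\<close> \<open>r < r'\<close> z_K0 by (intro less_if_uniformly_less_on_K0) auto
    have Z_eq: "Z_partial (g_star H) E f m \<omega> y = ennreal (z y)" for y
    proof -
      have "ennreal (z y) = (MAX i\<in>{1..m}. ennreal (t i * h i y))"
        unfolding z_def using \<open>1 \<le> m\<close>
        by (subst mono_Max_commute[of ennreal]) (auto simp: mono_def ennreal_leI image_image)
      also have "\<dots> = Z_partial (g_star H) E f m \<omega> y"
        unfolding Z_partial_def
      proof (intro arg_cong[where f=Max] image_cong refl)
        fix i assume "i \<in> {1..m}"
        then obtain j where j: "i = Suc j" by (cases i) auto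
        show "ennreal (t i * h i y) = 1 / ennreal (\<Sum>j=1..i. E j \<omega>) * (ennreal (f i \<omega> y) / g_star H (f i \<omega>))"
          unfolding j arrival_eq using term_eq[of y j]
          by (simp add: h_def q_def X divide_ennreal_def mult_ac)
      qed
      finally show ?thesis by simp
    qed
    \<comment> \<open>\<open>arrival X m\<close> sums the first \<open>m + 1\<close> gaps, which is
      the threshold at stage \<open>m\<close>.\<close>
    have "esssup (density H (g_star H)) (\<lambda>h. SUP y. ennreal (h y) / (g_star H h * Z_partial (g_star H) E f m \<omega> y))
        \<le> ennreal (\<Sum>j=1..m+1. E j \<omega>)"
      unfolding Z_eq Suc_eq_plus1[symmetric] arrival_eq
    proof (rule esssup_le[OF z \<open>0 < r\<close>])
      show "r \<le> z y" for y using z_gt[of y] by simp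
      show "sup_const H \<le> ennreal r * ennreal (arrival X m)"
        using c arrival_pos[of m] \<open>0 < r\<close> by (simp add: r_def ennreal_mult[symmetric])
    qed
    then have "stopping_number H (g_star H) E f \<omega> \<le> of_nat m"
      unfolding stopping_number_def using \<open>1 \<le> m\<close> by (intro INF_lower) auto
    then show ?thesis by (simp add: sum_eq)
  qed
  then show ?thesis by (simp add: P_def I_def q_def)
qed

end

section \<open>From the stopping rule to the expectation bound\<close>

theorem mainTheorem6:
  fixes HH :: "('k::polish_space \<Rightarrow> real) set"
    and T :: "('k \<Rightarrow> real) topology"
    and H :: "('k \<Rightarrow> real) measure"
    and M :: "'w measure"
    and PP :: "'w \<Rightarrow> (real \<times> ('k \<Rightarrow> real)) set"
    and N :: "'v measure"
    and E :: "nat \<Rightarrow> 'v \<Rightarrow> real"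
    and f :: "nat \<Rightarrow> 'v \<Rightarrow> ('k \<Rightarrow> real)"
  assumes K_compact: "compact (UNIV :: 'k set)"
    and HH_nonneg: "\<And>h y. h \<in> HH \<Longrightarrow> 0 \<le> h y"
    and HH_polish: "topspace T = HH" "polish_topology T"
    and HH_order: "\<exists>K0 :: 'k set. countable K0 \<and>
          (\<forall>h1\<in>HH. \<forall>h2\<in>HH. (\<forall>y. h1 y < h2 y) \<longleftrightarrow> (\<exists>\<epsilon>>0. \<forall>y\<in>K0. h1 y < h2 y - \<epsilon>))"
    and HH_max: "\<And>h1 h2 t1 t2. \<lbrakk>h1 \<in> HH; h2 \<in> HH; 0 \<le> t1; 0 \<le> t2\<rbrakk> \<Longrightarrow>
          (\<lambda>y. max (t1 * h1 y) (t2 * h2 y)) \<in> HH"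
    and HH_one: "(\<lambda>_. 1) \<in> HH"
    and H_algebra: "space H = HH" "sets H = sigma_sets HH (cylinder_sets HH)"
    and H_locally_finite: "locally_finite_measure T H"
    and H_normalized: "\<And>y. (\<integral>\<^sup>+ h. ennreal (h y) \<partial>H) = 1"
    and M_prob: "prob_space M"
    and PP_poisson: "poisson_point_process M (spectral_intensity H) PP"
    and Z_pos: "AE \<omega> in M. 0 < (INF y. max_stable PP \<omega> y)"
    and sup_measurable: "(\<lambda>h. SUP y. ennreal (h y)) \<in> borel_measurable H"
    and sup_integrable: "sup_const H < \<infinity>"
    and N_prob: "prob_space N"
    and E_exponential: "\<And>j. 1 \<le> j \<Longrightarrow> distributed N lborel (E j) (exponential_density 1)"
    and f_measurable: "\<And>i. 1 \<le> i \<Longrightarrow> f i \<in> measurable N H"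
    and f_law: "\<And>i. 1 \<le> i \<Longrightarrow> distr N H (f i) = density H (g_star H)"
    and E_f_indep: "jointly_indep N H E f"
  shows "Q_number N H (g_star H) E f
           \<le> sup_const H * (\<integral>\<^sup>+ \<omega>. inverse (INF y. max_stable PP \<omega> y) \<partial>M)
       \<and> ((\<integral>\<^sup>+ \<omega>. inverse (INF y. max_stable PP \<omega> y) \<partial>M) < \<infinity> \<longrightarrow>
             Q_number N H (g_star H) E f < \<infinity>)"
proof -
  obtain K0 :: "'k set" where K0: "countable K0"
    "\<And>h1 h2. h1 \<in> HH \<Longrightarrow> h2 \<in> HH \<Longrightarrow> (\<forall>y. h1 y < h2 y) \<longleftrightarrow> (\<exists>\<epsilon>>0. \<forall>y\<in>K0. h1 y < h2 y - \<epsilon>)"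
    using HH_order by blast
  interpret spectral_functions HH H K0
    by (rule spectral_functions.intro) (fact | rule HH_nonneg HH_max K0(2) | assumption)+
  interpret N: prob_space N by fact
  define Q where "Q = density H (g_star H)"
  have sets_Q [measurable_cong]: "sets Q = sets H" by (simp add: Q_def)
  have space_Q: "space Q = HH" using space_H by (simp add: Q_def)
  have "prob_space Q"
    using N.prob_space_distr[OF f_measurable[of 1]] f_law[of 1] by (simp add: Q_def)
  then interpret marked_arrivals Q by (simp add: marked_arrivals_def)
  define q where "q = (\<lambda>y h. ennreal (h y) / g_star H h)"
  have q_meas [measurable]: "q y \<in> borel_measurable Q" for y
    unfolding q_def by measurable
  have q_le: "q y h \<le> ennreal (enn2real (sup_const H))" for y h
    unfolding q_def sup_const_real(1)[symmetric] by (rule quotient_g_star_le)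
  \<comment> \<open>An enumeration, possibly with repetitions, turns infima over \<open>K0\<close>
    into infima of sequences.\<close>
  define e where "e = from_nat_into K0"
  have e: "range e = K0"
    unfolding e_def by (rule range_from_nat_into[OF K0_nonempty K0(1)])
  define a where "a X = sup_const H * inverse (INF n. normalized_max q X (e n))" for X
  have a_meas [measurable]: "a \<in> borel_measurable S"
    unfolding a_def by measurable
  define X where "X \<omega> = to_stream (\<lambda>i. (E (Suc i) \<omega>, f (Suc i) \<omega>))" for \<omega>
  have law: "distr N S X = S"
    unfolding X_def using N_prob E_exponential f_measurable f_law E_f_indep
    by (intro distr_to_stream_eq_stream_space) (auto simp: Q_def)
  have E_meas [measurable]: "E (Suc i) \<in> borel_measurable N" for i
    using distributed_measurable[OF E_exponential[of "Suc i"]] by simp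
  have f_meas [measurable]: "f (Suc i) \<in> measurable N H" for i
    using f_measurable by simp
  have X_meas [measurable]: "X \<in> measurable N S"
    unfolding X_def by (rule measurable_stream_space2) (simp add: to_stream_def)
  have AE_pos: "AE \<omega> in N. \<forall>i. 0 < E (Suc i) \<omega>"
    unfolding AE_all_countable
  proof
    fix i
    have "expo = distr N lborel (E (Suc i))"
      using distributed_distr_eq_density[OF E_exponential[of "Suc i"]] by (simp add: expo_def)
    then have "AE x in distr N lborel (E (Suc i)). 0 < x"
      using AE_expo_pos by (rule subst)
    then show "AE \<omega> in N. 0 < E (Suc i) \<omega>" by (subst (asm) AE_distr_iff) auto
  qed
  have AE_g: "AE \<omega> in N. \<forall>i. 0 < g_star H (f (Suc i) \<omega>) \<and> g_star H (f (Suc i) \<omega>) < \<infinity>"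
    unfolding AE_all_countable
  proof
    fix i
    \<comment> \<open>The zeros of \<open>g_star\<close> are null for the measure with density
      \<open>g_star\<close>.\<close>
    have "AE h in density H (g_star H). 0 < g_star H h \<and> g_star H h < \<infinity>"
      using AE_g_star_finite by (subst AE_density) auto
    then have "AE h in distr N H (f (Suc i)). 0 < g_star H h \<and> g_star H h < \<infinity>"
      by (subst f_law) simp_all
    then show "AE \<omega> in N. 0 < g_star H (f (Suc i) \<omega>) \<and> g_star H (f (Suc i) \<omega>) < \<infinity>"
      by (subst (asm) AE_distr_iff) auto
  qed
  have AE_stop: "AE \<omega> in N. stopping_number H (g_star H) E f \<omega>
      \<le> (\<Sum>i. if ennreal (arrival (X \<omega>) i) \<le> a (X \<omega>) then 1 else 0)"
    using AE_pos AE_g AE_space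
  proof eventually_elim
    case (elim \<omega>)
    have "f (Suc i) \<omega> \<in> HH" for i
      using measurable_space[OF f_meas elim(3)] space_H by simp
    then show ?case
      using stopping_number_le[of E \<omega> f] elim
      by (simp add: a_def X_def q_def e[symmetric] image_image)
  qed
  \<comment> \<open>Monotonicity of \<open>nn_integral\<close> suffices; measurability of
    \<open>stopping_number\<close> is not established.\<close>
  have "Q_number N H (g_star H) E f \<le> (\<integral>\<^sup>+\<omega>. (\<Sum>i. if ennreal (arrival (X \<omega>) i) \<le> a (X \<omega>) then 1 else 0) \<partial>N)"
    unfolding Q_number_def using AE_stop by (rule nn_integral_mono_AE)
  also have "\<dots> = (\<integral>\<^sup>+Y. (\<Sum>i. if ennreal (arrival Y i) \<le> a Y then 1 else 0) \<partial>distr N S X)"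
    by (rule nn_integral_distr[symmetric]) measurable
  also have "\<dots> = (\<integral>\<^sup>+Y. (\<Sum>i. if ennreal (arrival Y i) \<le> a Y then 1 else 0) \<partial>S)"
    by (simp only: law)
  also have "\<dots> \<le> (\<integral>\<^sup>+Y. a Y \<partial>S)"
  proof (rule expected_arrivals_before_le[OF a_meas])
    show "a Y \<le> a (merge_at i Y)" for Y i
      unfolding a_def by (intro mult_left_mono inverse_antimono_ennreal INF_mono') (auto intro: normalized_max_merge_at)
  qed
  also have "\<dots> = sup_const H * (\<integral>\<^sup>+Y. inverse (INF n. normalized_max q Y (e n)) \<partial>S)"
    unfolding a_def by (rule nn_integral_cmult) measurable
  also have "(\<integral>\<^sup>+Y. inverse (INF n. normalized_max q Y (e n)) \<partial>S)
      = (\<integral>\<^sup>+\<omega>. inverse (INF n. max_stable PP \<omega> (e n)) \<partial>M)"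
  proof (rule nn_integral_inverse_INF_eq[OF prob_space_S M_prob])
    show "(\<lambda>\<omega>. max_stable PP \<omega> (e n)) \<in> borel_measurable M" for n
      by (rule measurable_max_stable[OF PP_poisson]) measurable
    show "(\<lambda>Y. normalized_max q Y (e n)) \<in> borel_measurable S" for n
      by measurable
    fix G :: "nat set" and s :: real assume G: "finite G" and s: "0 < s"
    \<comment> \<open>The exponent is at most \<open>c / s\<close>, so the void probability formula
      for sets of finite intensity applies.\<close>
    have fin: "(\<integral>\<^sup>+h. (SUP y\<in>e ` G. ennreal (h y)) / ennreal s \<partial>H) < \<infinity>"
    proof -
      have "(\<integral>\<^sup>+h. (SUP y\<in>e ` G. ennreal (h y)) / ennreal s \<partial>H) \<le> (\<integral>\<^sup>+h. (SUP y. ennreal (h y)) / ennreal s \<partial>H)"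
        by (intro nn_integral_mono divide_right_mono_ennreal SUP_subset_mono) auto
      also have "\<dots> = sup_const H / ennreal s"
        unfolding sup_const_def divide_ennreal_def by (rule nn_integral_multc) fact
      also have "\<dots> < \<infinity>"
        using sup_const_real(1) s by (metis divide_ennreal enn2real_nonneg ennreal_less_top infinity_ennreal_def)
      finally show ?thesis .
    qed
    have "emeasure S {Y\<in>space S. \<forall>n\<in>G. normalized_max q Y (e n) \<le> ennreal s}
      = emeasure S {Y\<in>space S. \<forall>y\<in>e ` G. normalized_max q Y y \<le> ennreal s}"
      by simp
    also have "\<dots> = ennreal (exp (- enn2real (\<integral>\<^sup>+h. (SUP y\<in>e ` G. q y h) / ennreal s \<partial>Q)))"
      using G s q_le by (intro normalized_max_finite_dimensional) auto
    also have "(\<integral>\<^sup>+h. (SUP y\<in>e ` G. q y h) / ennreal s \<partial>Q)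
      = (\<integral>\<^sup>+h. (SUP y\<in>e ` G. ennreal (h y)) / ennreal s \<partial>H)"
      unfolding q_def Q_def using G by (intro nn_integral_SUP_quotient_g_star) auto
    also have "ennreal (exp (- enn2real \<dots>)) = emeasure M {\<omega>\<in>space M. \<forall>y\<in>e ` G. max_stable PP \<omega> y \<le> ennreal s}"
    proof (rule max_stable_finite_dimensional[symmetric])
      show "sigma_finite_measure H"
        using HH_polish H_locally_finite space_H by (intro sigma_finite_if_locally_finite) auto
    qed (use M_prob PP_poisson HH_nonneg space_H G s fin in auto)
    also have "\<dots> = emeasure M {\<omega>\<in>space M. \<forall>n\<in>G. max_stable PP \<omega> (e n) \<le> ennreal s}"
      by simp
    finally show "emeasure S {Y\<in>space S. \<forall>n\<in>G. normalized_max q Y (e n) \<le> ennreal s}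
      = emeasure M {\<omega>\<in>space M. \<forall>n\<in>G. max_stable PP \<omega> (e n) \<le> ennreal s}" .
  qed
  \<comment> \<open>Passing from \<open>K0\<close> to all of \<open>K\<close> lowers the infimum and
    raises its reciprocal; monotonicity requires no measurability of the infimum over
    \<open>K\<close>.\<close>
  also have "sup_const H * (\<integral>\<^sup>+\<omega>. inverse (INF n. max_stable PP \<omega> (e n)) \<partial>M)
      \<le> sup_const H * (\<integral>\<^sup>+\<omega>. inverse (INF y. max_stable PP \<omega> y) \<partial>M)"
    by (intro mult_left_mono nn_integral_mono inverse_antimono_ennreal INF_greatest INF_lower) simp_all
  finally have bound: "Q_number N H (g_star H) E f
      \<le> sup_const H * (\<integral>\<^sup>+ \<omega>. inverse (INF y. max_stable PP \<omega> y) \<partial>M)" .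
  moreover have "Q_number N H (g_star H) E f < \<infinity>"
    if "(\<integral>\<^sup>+ \<omega>. inverse (INF y. max_stable PP \<omega> y) \<partial>M) < \<infinity>"
    using bound by (rule le_less_trans) (use that sup_integrable in \<open>simp add: ennreal_mult_less_top\<close>)
  ultimately show ?thesis by blast
qed

end
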